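(* Let $0<p<1$ and $\Phi\in L^1_{loc}(\mathbb{R}^n\setminus\{0\})$. Let $X$ be a translation invariant (quasi-)Banach space. Suppose $C_c^\infty(\mathbb{R}^n)\subset X$ and $X\hookrightarrow L^p_0(\mathbb{R}^n)$, where the latter means that for every $\varphi\in C_c^\infty(\mathbb{R}^n)$ we have $\|\varphi*f\|_{L^p(\mathbb{R}^n)}\le C\|f\|_X$ for all $f\in X$, with a constant $C$ depending only on $\varphi$. Then $$H_\Phi \text{ is bounded on } X \iff H_\Phi=0.$$
   Context: The Hausdorff operator associated with $\Phi$ is $$H_\Phi f(x)=\int_{\mathbb{R}^n}\Phi(y)\,f\!\left(\frac{x}{|y|}\right)dy .$$ $L^1_{loc}(\mathbb{R}^n\setminus\{0\})$ is the set of measurable functions that are integrable on every compact subset of $\mathbb{R}^n\setminus\{0\}$, and $C_c^\infty(\mathbb{R}^n)$ is the set of smooth compactly supported functions on $\mathbb{R}^n$. The elements of $X$ are functions or distributions on $\mathbb{R}^n$. Translation invariant means $\|T_yf\|_X=\|f\|_X$ for all $f\in X$ and $y\in\mathbb{R}^n$, where $T_yf(x)=f(x-y)$. As usual, $\|g\|_{L^p}=\left(\int_{\mathbb{R}^n}|g(x)|^p\,dx\right)^{1/p}$. "$H_\Phi$ is bounded on $X$" has its usual meaning, namely $\|H_\Phi f\|_X\le C'\|f\|_X$ for all $f\in X$ with a constant $C'$ independent of $f$; "$H_\Phi=0$" means that $H_\Phi$ is the zero operator. *)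

theory Defs
  imports "HOL-Analysis.Analysis"
begin

definition dir_deriv ::
  "real^'n \<Rightarrow> (real^'n \<Rightarrow> complex) \<Rightarrow> real^'n \<Rightarrow> complex" where
  "dir_deriv v f = (\<lambda>x. frechet_derivative f (at x) v)"

text \<open>Frechet differentiability of all iterated directional derivatives, i.e. class C-infinity.\<close>

definition smooth :: "(real^'n \<Rightarrow> complex) \<Rightarrow> bool" where
  "smooth f \<longleftrightarrow> (\<forall>vs x. foldr dir_deriv vs f differentiable at x)"

definition supp :: "(real^'n \<Rightarrow> complex) \<Rightarrow> (real^'n) set" where
  "supp f = closure {x. f x \<noteq> 0}"

definition test_functions :: "(real^'n \<Rightarrow> complex) set" where
  "test_functions = {\<phi>. smooth \<phi> \<and> compact (supp \<phi>)}"

definition locally_integrable_on ::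
  "(real^'n \<Rightarrow> complex) \<Rightarrow> (real^'n) set \<Rightarrow> bool"  (infix "locally'_integrable'_on" 46) where
  "f locally_integrable_on S \<longleftrightarrow>
     f \<in> borel_measurable (lebesgue_on S) \<and>
     (\<forall>K. compact K \<and> K \<subseteq> S \<longrightarrow> f absolutely_integrable_on K)"

definition in_Lp :: "real \<Rightarrow> (real^'n \<Rightarrow> complex) \<Rightarrow> bool" where
  "in_Lp p g \<longleftrightarrow> g \<in> borel_measurable lebesgue \<and>
     integrable lebesgue (\<lambda>x. norm (g x) powr p)"

definition Lp_norm :: "real \<Rightarrow> (real^'n \<Rightarrow> complex) \<Rightarrow> real" where
  "Lp_norm p g = (LINT x|lebesgue. norm (g x) powr p) powr (1 / p)"

text \<open>A distribution is a functional on the test functions.  It is extended by 0 to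
  all functions, so that distributions are equal iff they agree on test functions.
  Continuity is the usual seminorm estimate on every compact set.\<close>

type_synonym 'n functional = "(real^'n \<Rightarrow> complex) \<Rightarrow> complex"

definition distributions :: "'n::finite functional set" where
  "distributions = {u.
     (\<forall>\<phi>. \<phi> \<notin> test_functions \<longrightarrow> u \<phi> = 0) \<and>
     (\<forall>\<phi>\<in>test_functions. \<forall>\<psi>\<in>test_functions. u (\<lambda>x. \<phi> x + \<psi> x) = u \<phi> + u \<psi>) \<and>
     (\<forall>c. \<forall>\<phi>\<in>test_functions. u (\<lambda>x. c * \<phi> x) = c * u \<phi>) \<and>
     (\<forall>K. compact K \<longrightarrow> (\<exists>C m. \<forall>\<phi>\<in>test_functions. supp \<phi> \<subseteq> K \<longrightarrow>
        norm (u \<phi>) \<le> C * (\<Sum>vs | set vs \<subseteq> Basis \<and> length vs \<le> m.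
                              SUP x. norm (foldr dir_deriv vs \<phi> x))))}"

definition fun_distr :: "(real^'n \<Rightarrow> complex) \<Rightarrow> 'n::finite functional" where
  "fun_distr f = (\<lambda>\<phi>. if \<phi> \<in> test_functions then LINT x|lebesgue. f x * \<phi> x else 0)"

definition translate :: "real^'n \<Rightarrow> 'n::finite functional \<Rightarrow> 'n functional" where
  "translate y u = (\<lambda>\<phi>. u (\<lambda>x. \<phi> (x + y)))"

definition convol :: "(real^'n \<Rightarrow> complex) \<Rightarrow> 'n::finite functional \<Rightarrow> real^'n \<Rightarrow> complex" where
  "convol \<phi> u = (\<lambda>x. u (\<lambda>y. \<phi> (x - y)))"

definition quasi_banach ::
  "'n::finite functional set \<Rightarrow> ('n functional \<Rightarrow> real) \<Rightarrow> bool" where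
  "quasi_banach X N \<longleftrightarrow>
     X \<subseteq> distributions \<and>
     (\<lambda>\<phi>. 0) \<in> X \<and>
     (\<forall>u\<in>X. \<forall>v\<in>X. (\<lambda>\<phi>. u \<phi> + v \<phi>) \<in> X) \<and>
     (\<forall>c. \<forall>u\<in>X. (\<lambda>\<phi>. c * u \<phi>) \<in> X) \<and>
     (\<forall>u\<in>X. N u \<ge> 0) \<and>
     (\<forall>u\<in>X. N u = 0 \<longleftrightarrow> u = (\<lambda>\<phi>. 0)) \<and>
     (\<forall>c. \<forall>u\<in>X. N (\<lambda>\<phi>. c * u \<phi>) = norm c * N u) \<and>
     (\<exists>K. \<forall>u\<in>X. \<forall>v\<in>X. N (\<lambda>\<phi>. u \<phi> + v \<phi>) \<le> K * (N u + N v)) \<and>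
     (\<forall>s. (\<forall>k. s k \<in> X) \<and>
          (\<forall>e>0. \<exists>M. \<forall>j\<ge>M. \<forall>k\<ge>M. N (\<lambda>\<phi>. s j \<phi> - s k \<phi>) < e) \<longrightarrow>
          (\<exists>u\<in>X. (\<lambda>k. N (\<lambda>\<phi>. s k \<phi> - u \<phi>)) \<longlonglongrightarrow> 0))"

definition translation_invariant ::
  "'n::finite functional set \<Rightarrow> ('n functional \<Rightarrow> real) \<Rightarrow> bool" where
  "translation_invariant X N \<longleftrightarrow>
     (\<forall>u\<in>X. \<forall>y. translate y u \<in> X \<and> N (translate y u) = N u)"

definition embeds_Lp0 ::
  "real \<Rightarrow> 'n::finite functional set \<Rightarrow> ('n functional \<Rightarrow> real) \<Rightarrow> bool" where
  "embeds_Lp0 p X N \<longleftrightarrow>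
     (\<forall>\<phi>\<in>test_functions. \<exists>C. \<forall>u\<in>X.
        in_Lp p (convol \<phi> u) \<and> Lp_norm p (convol \<phi> u) \<le> C * N u)"

definition hausdorff_fun ::
  "(real^'n \<Rightarrow> complex) \<Rightarrow> (real^'n \<Rightarrow> complex) \<Rightarrow> real^'n \<Rightarrow> complex" where
  "hausdorff_fun \<Phi> f x = (LINT y|lebesgue. \<Phi> y * f (x /\<^sub>R norm y))"

text \<open>\<open>has_hausdorff \<Phi> u v\<close> means that the Hausdorff operator is defined at \<open>u\<close>, with value \<open>v\<close>.
  If \<open>u\<close> is given by a locally integrable function, the defining integral has to converge
  absolutely at almost every point and \<open>v\<close> is given by the resulting function.  For other
  distributions the same integral is taken in the weak sense: the dilation
  \<open>u(\<cdot> / r)\<close> maps \<open>g\<close> to \<open>r ^ n * u (g (r \<cdot>))\<close>, as one sees for functions \<open>u\<close> by substitution.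

  It is a relation since the Bochner integral has the value 0 where it diverges, and
  divergence must not be mistaken for the operator being zero.\<close>

definition has_hausdorff ::
  "(real^'n \<Rightarrow> complex) \<Rightarrow> 'n::finite functional \<Rightarrow> 'n functional \<Rightarrow> bool" where
  "has_hausdorff \<Phi> u v \<longleftrightarrow>
     (if \<exists>f. f locally_integrable_on UNIV \<and> u = fun_distr f
      then \<exists>f h. f locally_integrable_on UNIV \<and> u = fun_distr f \<and>
                 h locally_integrable_on UNIV \<and> v = fun_distr h \<and>
                 (AE x in lebesgue. integrable lebesgue (\<lambda>y. \<Phi> y * f (x /\<^sub>R norm y)) \<and>
                                    h x = hausdorff_fun \<Phi> f x)
      else v \<in> distributions \<and>
           (\<forall>g\<in>test_functions.
              integrable lebesgue
                (\<lambda>y. \<Phi> y * (of_real (norm y ^ CARD('n)) * u (\<lambda>x. g (norm y *\<^sub>R x)))) \<and>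
              v g = (LINT y|lebesgue.
                \<Phi> y * (of_real (norm y ^ CARD('n)) * u (\<lambda>x. g (norm y *\<^sub>R x))))))"

definition hausdorff_bounded ::
  "(real^'n \<Rightarrow> complex) \<Rightarrow> 'n::finite functional set \<Rightarrow> ('n functional \<Rightarrow> real) \<Rightarrow> bool" where
  "hausdorff_bounded \<Phi> X N \<longleftrightarrow>
     (\<exists>C. \<forall>u\<in>X. \<exists>v\<in>X. has_hausdorff \<Phi> u v \<and> N v \<le> C * N u)"

definition hausdorff_zero ::
  "(real^'n \<Rightarrow> complex) \<Rightarrow> 'n::finite functional set \<Rightarrow> bool" where
  "hausdorff_zero \<Phi> X \<longleftrightarrow> (\<forall>u\<in>X. has_hausdorff \<Phi> u (\<lambda>\<phi>. 0))"

end

theory Submission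
  imports Defs "HOL-Real_Asymp.Real_Asymp"
begin

text \<open>
  Let \<open>\<beta>\<close> be a nonnegative bump, \<open>e\<close> a unit vector, and apply \<open>H\<close> to the translates
  \<open>\<beta> (\<cdot> - R e)\<close>, which all have the same norm in \<open>X\<close>.  The image is spread over a
  tube of length of order \<open>R\<close>, where it has size of order \<open>1 / R\<close>.  Since \<open>p < 1\<close>, the bound on
  the \<open>L\<^sup>p\<close> quasi-norm of its convolution with \<open>\<beta>\<close>, uniform in \<open>R\<close>, forces the integral of
  that convolution over the tube to tend to 0.  Weighting by \<open>\<eta> (norm x / R)\<close>, the limit is a
  multiple of the integral of \<open>norm y ^ n * \<Phi> y * \<eta> (norm y)\<close>.  Hence \<open>\<Phi>\<close> integrates to 0 against
  all radial functions, and \<open>H = 0\<close>, because the integrand of \<open>H\<close> is \<open>\<Phi>\<close> times a radial function.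
\<close>

subsection \<open>Smooth functions and bumps\<close>

text \<open>The decay in \<open>R\<close> comes from the inner variable: a point \<open>x\<close>
  sees only those \<open>y\<close> with \<open>norm y\<close> close to \<open>norm x / R\<close>, a
  spherical shell of thickness of order \<open>1 / R\<close>. Integrated over \<open>x\<close>,
  however, the contribution of a single \<open>y\<close> is independent of \<open>R\<close>; so
  height decays while mean persists. Two obstacles shape the estimates. The kernel
  \<open>\<Phi>\<close> is merely integrable on shells, so its integral over a thin shell need not
  be of order \<open>1 / R\<close>; its large values are split off and controlled in mean, uniformly
  in \<open>R\<close>. Moreover \<open>\<Phi>\<close> may fail to be integrable near 0 and near
  infinity, so the image is examined only where \<open>norm x / R\<close> stays in a compact
  interval of positive numbers; there only a fixed shell of \<open>y\<close> contributes. The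
  convolution is dictated by the embedding. It only thickens the picture by the radius of the bump,
  which rescaling by \<open>R\<close> makes negligible. Cancellation against radial functions does
  not by itself give the zero operator: the defining integrals must also converge at every element
  of \<open>X\<close>. This convergence is supplied by the boundedness of the operator.\<close>

text \<open>The outer factor \<open>k\<close> makes the shape reproduce itself: each further
  derivative only multiplies the factor by \<open>of_real c\<close>, as an induction over the list
  of directions requires.\<close>

lemma dir_deriv_affine:
  fixes f :: "real^'n \<Rightarrow> complex"
  assumes "\<And>x. f differentiable at x"
  shows "dir_deriv v (\<lambda>x. k * f (a + c *\<^sub>R x)) = (\<lambda>x. (k * of_real c) * dir_deriv v f (a + c *\<^sub>R x))"
    and "(\<lambda>x. k * f (a + c *\<^sub>R x)) differentiable at x"
proof -
  have D: "((\<lambda>x. k * f (a + c *\<^sub>R x)) has_derivative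
        (\<lambda>h. k * frechet_derivative f (at (a + c *\<^sub>R x)) (c *\<^sub>R h))) (at x)" for x
  proof -
    have "(f has_derivative frechet_derivative f (at (a + c *\<^sub>R x))) (at (a + c *\<^sub>R x))"
      using assms frechet_derivative_works by blast
    moreover have "((\<lambda>x. a + c *\<^sub>R x) has_derivative (\<lambda>h. c *\<^sub>R h)) (at x)"
      by (auto intro!: derivative_eq_intros)
    ultimately have "((\<lambda>x. f (a + c *\<^sub>R x)) has_derivative (\<lambda>h. frechet_derivative f (at (a + c *\<^sub>R x)) (c *\<^sub>R h))) (at x)"
      using diff_chain_at[of "\<lambda>x. a + c *\<^sub>R x" _ x f] by (simp add: o_def)
    then show ?thesis by (rule has_derivative_mult_right)
  qed
  show "(\<lambda>x. k * f (a + c *\<^sub>R x)) differentiable at x"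
    using D differentiable_def by blast
  have "frechet_derivative f (at y) (c *\<^sub>R v) = of_real c * frechet_derivative f (at y) v" for y
    using linear_cmul[OF linear_frechet_derivative[OF assms[of y]], of c v]
    by (simp add: scaleR_conv_of_real)
  then show "dir_deriv v (\<lambda>x. k * f (a + c *\<^sub>R x)) = (\<lambda>x. (k * of_real c) * dir_deriv v f (a + c *\<^sub>R x))"
    unfolding dir_deriv_def fun_eq_iff frechet_derivative_at[OF D, symmetric] by simp
qed

lemma foldr_dir_deriv_affine:
  assumes "smooth f"
  shows "foldr dir_deriv vs (\<lambda>x. f (a + c *\<^sub>R x)) =
    (\<lambda>x. of_real c ^ length vs * foldr dir_deriv vs f (a + c *\<^sub>R x))"
proof (induction vs)
  case (Cons v vs)
  have "\<And>x. foldr dir_deriv vs f differentiable at x"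
    using assms by (simp add: smooth_def)
  from dir_deriv_affine(1)[OF this] show ?case
    by (simp add: Cons.IH mult.commute)
qed simp

lemma smooth_affine:
  assumes "smooth f"
  shows "smooth (\<lambda>x. f (a + c *\<^sub>R x))"
  unfolding smooth_def[of "\<lambda>x. f (a + c *\<^sub>R x)"] foldr_dir_deriv_affine[OF assms]
  using assms by (intro allI dir_deriv_affine(2)) (simp add: smooth_def)

lemma foldr_dir_deriv_diff:
  assumes "smooth f" "smooth g"
  shows "foldr dir_deriv vs (\<lambda>x. f x - g x) = (\<lambda>x. foldr dir_deriv vs f x - foldr dir_deriv vs g x)"
proof (induction vs)
  case (Cons v vs)
  have *: "foldr dir_deriv vs f differentiable at x" "foldr dir_deriv vs g differentiable at x" for x
    using assms by (simp_all add: smooth_def)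
  have D: "((\<lambda>x. foldr dir_deriv vs f x - foldr dir_deriv vs g x) has_derivative
      (\<lambda>h. frechet_derivative (foldr dir_deriv vs f) (at x) h - frechet_derivative (foldr dir_deriv vs g) (at x) h)) (at x)" for x
    using * by (intro has_derivative_diff) (simp_all add: frechet_derivative_works[symmetric])
  have "dir_deriv v (\<lambda>x. foldr dir_deriv vs f x - foldr dir_deriv vs g x) =
      (\<lambda>x. dir_deriv v (foldr dir_deriv vs f) x - dir_deriv v (foldr dir_deriv vs g) x)"
    unfolding dir_deriv_def[of v "\<lambda>x. foldr dir_deriv vs f x - foldr dir_deriv vs g x"]
      frechet_derivative_at[OF D, symmetric] by (simp add: dir_deriv_def)
  then show ?case
    by (simp add: Cons.IH)
qed simp

lemma smooth_diff: "smooth f \<Longrightarrow> smooth g \<Longrightarrow> smooth (\<lambda>x. f x - g x)"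
  unfolding smooth_def[of "\<lambda>x. f x - g x"]
  by (simp add: foldr_dir_deriv_diff) (simp add: smooth_def)

lemma foldr_dir_deriv_continuous: "smooth f \<Longrightarrow> continuous_on A (foldr dir_deriv vs f)"
  by (meson continuous_at_imp_continuous_on differentiable_imp_continuous_within smooth_def)

lemma smooth_continuous: "smooth f \<Longrightarrow> continuous_on A f"
  using foldr_dir_deriv_continuous[of f A "[]"] by simp

lemma smooth_measurable: "smooth f \<Longrightarrow> f \<in> borel_measurable borel"
  by (simp add: borel_measurable_continuous_onI smooth_continuous)

lemma not_in_supp: "x \<notin> supp f \<Longrightarrow> f x = 0"
  using closure_subset[of "{x. f x \<noteq> 0}"] by (auto simp: supp_def)

lemma supp_subsetI: "closed K \<Longrightarrow> (\<And>x. x \<notin> K \<Longrightarrow> f x = 0) \<Longrightarrow> supp f \<subseteq> K"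
  unfolding supp_def by (rule closure_minimal) auto

lemma test_functionI:
  assumes "smooth f" "compact K" "\<And>x. x \<notin> K \<Longrightarrow> f x = 0"
  shows "f \<in> test_functions"
proof -
  have "supp f \<subseteq> K" using assms supp_subsetI compact_imp_closed by blast
  moreover have "closed (supp f)" by (simp add: supp_def)
  ultimately have "compact (supp f)" using assms(2) by (metis compact_Int_closed inf.absorb2)
  then show ?thesis using assms by (simp add: test_functions_def)
qed

lemma test_function_affine:
  assumes f: "f \<in> test_functions" and "c \<noteq> 0"
  shows "(\<lambda>x. f (a + c *\<^sub>R x)) \<in> test_functions"
proof (rule test_functionI)
  show "smooth (\<lambda>x. f (a + c *\<^sub>R x))" using f by (simp add: test_functions_def smooth_affine)
  show "compact ((\<lambda>y. - ((1/c) *\<^sub>R a) + (1/c) *\<^sub>R y) ` supp f)"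
    using f by (intro compact_affinity) (simp add: test_functions_def)
  fix x assume "x \<notin> (\<lambda>y. - ((1/c) *\<^sub>R a) + (1/c) *\<^sub>R y) ` supp f"
  moreover have "x = - ((1/c) *\<^sub>R a) + (1/c) *\<^sub>R (a + c *\<^sub>R x)"
    using \<open>c \<noteq> 0\<close> by (simp add: algebra_simps)
  ultimately have "a + c *\<^sub>R x \<notin> supp f" by blast
  then show "f (a + c *\<^sub>R x) = 0" by (rule not_in_supp)
qed

lemma test_function_shift_iff: "(\<lambda>x. f (x + a)) \<in> test_functions \<longleftrightarrow> f \<in> test_functions"
  using test_function_affine[of f 1 a] test_function_affine[of "\<lambda>x. f (x + a)" 1 "-a"]
  by (auto simp: add.commute)

section \<open>Bumps on boxes, built from exp(-1/t)\<close>

lemma smooth_coinduct: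
  fixes F :: "(real^'n \<Rightarrow> complex) set"
  assumes "f \<in> F" and "\<And>f x. f \<in> F \<Longrightarrow> f differentiable at x"
    and "\<And>f v. f \<in> F \<Longrightarrow> dir_deriv v f \<in> F"
  shows "smooth f"
proof -
  have "foldr dir_deriv vs f \<in> F" for vs
    by (induction vs) (auto simp: assms)
  then show ?thesis using assms(2) by (simp add: smooth_def)
qed

text \<open>The classical flat function is the case \<open>m = 0\<close>. Its derivatives carry
  negative powers of \<open>t\<close>; allowing the division by \<open>t ^ m\<close> makes the
  family closed under differentiation up to linear combinations.\<close>

definition flat :: "nat \<Rightarrow> real \<Rightarrow> real" where
  "flat m t = (if t > 0 then exp (- 1 / t) / t ^ m else 0)"

lemma flat_nonneg: "flat m t \<ge> 0" and flat_le_1: "flat 0 t \<le> 1" and flat_pos: "t > 0 \<Longrightarrow> flat m t > 0"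
  by (auto simp: flat_def)

lemma flat_deriv: "(flat m has_real_derivative flat (Suc (Suc m)) t - real m * flat (Suc m) t) (at t)"
proof -
  consider "t > 0" | "t < 0" | "t = 0" by linarith
  then show ?thesis
  proof cases
    case 1
    have "((\<lambda>t. exp (- 1 / t) / t ^ m) has_real_derivative
        flat (Suc (Suc m)) t - real m * flat (Suc m) t) (at t)"
    proof -
      have e: "real m * t ^ (m - Suc 0) = real m * t ^ m / t"
        using 1 by (cases m) auto
      have "((\<lambda>t. exp (- 1 / t) / t ^ m) has_real_derivative
          (exp (- 1 / t) * (1 / t\<^sup>2) * t ^ m - exp (- 1 / t) * (real m * t ^ (m - Suc 0))) / (t ^ m * t ^ m)) (at t)"
        using 1 by (auto intro!: derivative_eq_intros simp: power2_eq_square)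
      also have "(exp (- 1 / t) * (1 / t\<^sup>2) * t ^ m - exp (- 1 / t) * (real m * t ^ (m - Suc 0))) / (t ^ m * t ^ m)
          = flat (Suc (Suc m)) t - real m * flat (Suc m) t"
        unfolding e using 1 by (simp add: flat_def field_simps power2_eq_square)
      finally show ?thesis .
    qed
    then show ?thesis
      by (rule DERIV_cong_ev[OF refl _ refl, THEN iffD1, rotated])
         (use eventually_nhds_in_open[of "{0<..}" t] 1 in \<open>auto elim!: eventually_mono simp: flat_def\<close>)
  next
    case 2
    have "((\<lambda>t. 0) has_real_derivative flat (Suc (Suc m)) t - real m * flat (Suc m) t) (at t)"
      using 2 by (simp add: flat_def)
    then show ?thesis
      by (rule DERIV_cong_ev[OF refl _ refl, THEN iffD1, rotated])
         (use eventually_nhds_in_open[of "{..<0}" t] 2 in \<open>auto elim!: eventually_mono simp: flat_def\<close>)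
  next
    case 3
    \<comment> \<open>The difference quotient of \<open>flat m\<close> at 0 is
      \<open>flat (Suc m)\<close>, so this limit is the derivative there, in agreement with the
      right-hand side of the recurrence at 0.\<close>
    have "((\<lambda>h. flat (Suc m) h) \<longlongrightarrow> 0) (at 0)"
    proof (rule filterlim_split_at)
      show "((\<lambda>h. flat (Suc m) h) \<longlongrightarrow> 0) (at_left 0)"
        by (rule tendsto_eventually) (auto simp: eventually_at_filter flat_def)
      have "((\<lambda>h::real. exp (- 1 / h) / h ^ Suc m) \<longlongrightarrow> 0) (at_right 0)"
        by real_asymp
      then show "((\<lambda>h. flat (Suc m) h) \<longlongrightarrow> 0) (at_right 0)"
        by (rule tendsto_cong[THEN iffD1, rotated]) (auto simp: eventually_at_filter flat_def)
    qed
    moreover have "flat m h / h = flat (Suc m) h" for h by (simp add: flat_def)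
    ultimately show ?thesis using 3
      by (simp add: DERIV_def flat_def[of _ 0])
  qed
qed

text \<open>A class containing the box bumps and stable under differentiation. The coordinates
  belong to it because the inner quadratic polynomial in \<open>flat\<close> has an affine
  derivative.\<close>

inductive_set elementary :: "(real^'n \<Rightarrow> complex) set" where
  const: "(\<lambda>x. c) \<in> elementary"
| coord: "(\<lambda>x. of_real (x $ i)) \<in> elementary"
| flat: "(\<lambda>x. of_real (flat m (k * ((x $ i - a) * (b - x $ i))))) \<in> elementary"
| add: "f \<in> elementary \<Longrightarrow> g \<in> elementary \<Longrightarrow> (\<lambda>x. f x + g x) \<in> elementary"
| mult: "f \<in> elementary \<Longrightarrow> g \<in> elementary \<Longrightarrow> (\<lambda>x. f x * g x) \<in> elementary"

text \<open>The chain rule turns \<open>flat\<close> into \<open>flat\<close> of higher index times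
  an affine function, and the product rule produces sums of products. The derivative is given as an
  explicit witness \<open>D\<close>, so that its membership can be read off in the same
  induction.\<close>

lemma elementary_deriv:
  fixes f :: "real^'n \<Rightarrow> complex"
  assumes "f \<in> elementary"
  shows "\<exists>D. (\<forall>x. (f has_derivative D x) (at x)) \<and> (\<forall>v. (\<lambda>x. D x v) \<in> elementary)"
  using assms
proof induction
  case (const c)
  show ?case by (rule exI[of _ "\<lambda>x h. 0"]) (auto intro: elementary.const)
next
  case (coord i)
  have "((\<lambda>x. of_real (x $ i)) has_derivative (\<lambda>h. complex_of_real (h $ i))) (at x)" for x :: "real^'n"
    by (intro has_derivative_of_real bounded_linear_imp_has_derivative bounded_linear_vec_nth)
  then show ?case
    by (intro exI[of _ "\<lambda>x h. of_real (h $ i)"]) (auto intro: elementary.const)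
next
  case (flat m k i a b)
  define p where "p = (\<lambda>x::real^'n. k * ((x $ i - a) * (b - x $ i)))"
  define d where "d = (\<lambda>x::real^'n. flat (Suc (Suc m)) (p x) - real m * flat (Suc m) (p x))"
  define D where "D = (\<lambda>x h::real^'n. complex_of_real (d x * (k * ((a + b - 2 * x $ i) * h $ i))))"
  have nth: "((\<lambda>x. x $ i) has_derivative (\<lambda>h. h $ i)) (at x)" for x :: "real^'n"
    by (intro bounded_linear_imp_has_derivative bounded_linear_vec_nth)
  have "(p has_derivative (\<lambda>h. k * ((a + b - 2 * x $ i) * h $ i))) (at x)" for x
    unfolding p_def by (rule derivative_eq_intros nth refl)+ (auto simp: algebra_simps)
  moreover have "(flat m has_derivative (\<lambda>h. d x * h)) (at (p x))" for x
    using flat_deriv[of m "p x"] by (simp add: has_field_derivative_def d_def)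
  ultimately have "((\<lambda>x. flat m (p x)) has_derivative (\<lambda>h. d x * (k * ((a + b - 2 * x $ i) * h $ i)))) (at x)" for x
    using diff_chain_at[of p _ x "flat m" "\<lambda>h. d x * h"] by (simp add: o_def)
  then have "((\<lambda>x. complex_of_real (flat m (p x))) has_derivative D x) (at x)" for x
    unfolding D_def by (rule has_derivative_of_real)
  moreover have "(\<lambda>x. D x v) \<in> elementary" for v
  proof -
    have "(\<lambda>x. D x v) = (\<lambda>x. (of_real (flat (Suc (Suc m)) (p x)) + of_real (- real m) * of_real (flat (Suc m) (p x))) *
        (of_real (k * v $ i) * (of_real (a + b) + (- 2) * of_real (x $ i))))"
      by (simp add: D_def d_def fun_eq_iff algebra_simps)
    also have "\<dots> \<in> elementary"
      unfolding p_def by (intro elementary.intros)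
    finally show ?thesis .
  qed
  ultimately show ?case unfolding p_def by blast
next
  case (add f g)
  then obtain D E where "\<forall>x. (f has_derivative D x) (at x)" "\<forall>v. (\<lambda>x. D x v) \<in> elementary"
    "\<forall>x. (g has_derivative E x) (at x)" "\<forall>v. (\<lambda>x. E x v) \<in> elementary" by blast
  then show ?case
    by (intro exI[of _ "\<lambda>x h. D x h + E x h"]) (auto intro: elementary.add has_derivative_add)
next
  case (mult f g)
  then obtain D E where "\<forall>x. (f has_derivative D x) (at x)" "\<forall>v. (\<lambda>x. D x v) \<in> elementary"
    "\<forall>x. (g has_derivative E x) (at x)" "\<forall>v. (\<lambda>x. E x v) \<in> elementary" by blast
  with mult(1,2) show ?case
    by (intro exI[of _ "\<lambda>x h. f x * E x h + D x h * g x"]) (auto intro!: elementary.add elementary.mult has_derivative_mult)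
qed

text \<open>The class never loses a function to differentiation, so first derivatives suffice and no
  formula for iterated ones is required.\<close>

lemma smooth_elementary: "f \<in> elementary \<Longrightarrow> smooth f"
proof (erule smooth_coinduct)
  fix f :: "real^'n \<Rightarrow> complex" and x v assume "f \<in> elementary"
  then obtain D where D: "\<And>x. (f has_derivative D x) (at x)" "\<And>v. (\<lambda>x. D x v) \<in> elementary"
    using elementary_deriv by blast
  show "f differentiable at x" using D(1) differentiable_def by blast
  show "dir_deriv v f \<in> elementary"
    unfolding dir_deriv_def frechet_derivative_at[OF D(1), symmetric] by (rule D(2))
qed

text \<open>Each quadratic is positive exactly between the two faces in its coordinate when
  \<open>k > 0\<close> and \<open>a $ i < b $ i\<close>. Letting \<open>k\<close> grow pushes the
  product up to the indicator of the box; \<open>k = 1\<close> later yields the bump to which the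
  operator is applied.\<close>

definition box_bump :: "real \<Rightarrow> real^'n \<Rightarrow> real^'n \<Rightarrow> real^'n \<Rightarrow> real" where
  "box_bump k a b x = (\<Prod>i\<in>UNIV. flat 0 (k * ((x $ i - a $ i) * (b $ i - x $ i))))"

lemma box_bump_nonneg: "0 \<le> box_bump k a b x"
  by (simp add: box_bump_def prod_nonneg flat_nonneg)

lemma box_bump_le_1: "box_bump k a b x \<le> 1"
  unfolding box_bump_def by (intro prod_le_1) (auto simp: flat_nonneg flat_le_1)

lemma box_bump_pos:
  assumes "x \<in> box a b" "k > 0"
  shows "0 < box_bump k a b x"
  unfolding box_bump_def using assms
  by (intro prod_pos flat_pos) (simp add: mem_box_cart)

lemma box_bump_eq_0:
  assumes "x \<notin> box a b" "\<And>i. a $ i < b $ i" "k > 0"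
  shows "box_bump k a b x = 0"
proof -
  obtain i where i: "x $ i \<le> a $ i \<or> b $ i \<le> x $ i"
    using assms(1) by (auto simp: mem_box_cart not_less)
  have "(x $ i - a $ i) * (b $ i - x $ i) \<le> 0"
    using i assms(2)[of i] by (auto simp: mult_le_0_iff)
  then have "k * ((x $ i - a $ i) * (b $ i - x $ i)) \<le> 0"
    using assms(3) by (simp add: mult_le_0_iff)
  then have "flat 0 (k * ((x $ i - a $ i) * (b $ i - x $ i))) = 0"
    unfolding flat_def by auto
  then show ?thesis unfolding box_bump_def by (intro prod_zero) auto
qed

lemma box_bump_test_function:
  assumes "\<And>i. a $ i < b $ i" "k > 0"
  shows "(\<lambda>x. complex_of_real (box_bump k a b x)) \<in> test_functions"
proof (rule test_functionI)
  have "(\<lambda>x. \<Prod>i\<in>I. complex_of_real (flat 0 (k * ((x $ i - a $ i) * (b $ i - x $ i))))) \<in> elementary"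
    if "finite I" for I
    using that by (induction I) (simp_all add: elementary.intros)
  then have "(\<lambda>x. complex_of_real (box_bump k a b x)) \<in> elementary"
    by (simp add: box_bump_def)
  then show "smooth (\<lambda>x. complex_of_real (box_bump k a b x))" by (rule smooth_elementary)
  show "compact (cbox a b)" by simp
  show "complex_of_real (box_bump k a b x) = 0" if "x \<notin> cbox a b" for x
    using that box_bump_eq_0[of x a b k] assms box_subset_cbox by fastforce
qed

lemma box_bump_tendsto:
  fixes a b :: "real^'n"
  assumes "\<And>i. a $ i < b $ i"
  shows "(\<lambda>k. box_bump (real (Suc k)) a b x) \<longlonglongrightarrow> indicator (box a b) x"
proof (cases "x \<in> box a b")
  case True
  have "(\<lambda>k. flat 0 (real (Suc k) * ((x $ i - a $ i) * (b $ i - x $ i)))) \<longlonglongrightarrow> 1" for i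
  proof -
    define s where "s = (x $ i - a $ i) * (b $ i - x $ i)"
    have s: "s > 0" using True by (simp add: s_def mem_box_cart)
    have "(\<lambda>k. exp (- 1 / (real (Suc k) * s))) \<longlonglongrightarrow> 1"
      using s by real_asymp
    then show ?thesis unfolding s_def[symmetric] using s
      by (simp add: flat_def)
  qed
  then have "(\<lambda>k. box_bump (real (Suc k)) a b x) \<longlonglongrightarrow> (\<Prod>i\<in>(UNIV::'n set). 1)"
    unfolding box_bump_def by (intro tendsto_prod)
  then show ?thesis using True by simp
next
  case False
  then show ?thesis using assms by (simp add: box_bump_eq_0)
qed

subsection \<open>Distributions and test functions\<close>

text \<open>Composition with dilations and Fubini for \<open>lborel\<close> ask for Borel functions,
  whereas \<open>\<Phi>\<close> and the representatives of distributions are only Lebesgue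
  measurable.\<close>

lemma lebesgue_measurable_complex_ex_borel:
  fixes f :: "'a::euclidean_space \<Rightarrow> complex"
  assumes f: "f \<in> borel_measurable lebesgue"
  obtains g where "g \<in> borel_measurable borel" "AE x in lborel. f x = g x"
proof -
  have "(\<lambda>x. Re (f x)) \<in> borel_measurable lebesgue" "(\<lambda>x. Im (f x)) \<in> borel_measurable lebesgue"
    using f by (auto intro: borel_measurable_Re borel_measurable_Im)
  then obtain g h where gh: "g \<in> borel_measurable lborel" "AE x in lborel. Re (f x) = g x"
    "h \<in> borel_measurable lborel" "AE x in lborel. Im (f x) = h x"
    using completion_ex_borel_measurable_real by metis
  show ?thesis
  proof
    show "(\<lambda>x. Complex (g x) (h x)) \<in> borel_measurable borel"
      using gh(1,3) by (auto simp: borel_measurable_complex_iff)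
    show "AE x in lborel. f x = Complex (g x) (h x)"
      using gh(2,4) by eventually_elim (simp add: complex_eq_iff)
  qed
qed

lemma test_function_bounded:
  assumes "\<phi> \<in> test_functions"
  obtains B r where "B > 0" "r > 0" "\<And>x. norm (\<phi> x) \<le> B" "\<And>x. norm x > r \<Longrightarrow> \<phi> x = 0"
proof -
  have c: "compact (supp \<phi>)" and s: "smooth \<phi>" using assms by (auto simp: test_functions_def)
  have "compact (\<phi> ` supp \<phi>)" using c s by (intro compact_continuous_image smooth_continuous)
  then have "bounded (\<phi> ` supp \<phi>)" by (rule compact_imp_bounded)
  then obtain B where B: "B > 0" "\<And>y. y \<in> \<phi> ` supp \<phi> \<Longrightarrow> norm y \<le> B"
    unfolding bounded_pos by blast
  obtain r where r: "r > 0" "\<And>y. y \<in> supp \<phi> \<Longrightarrow> norm y \<le> r"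
    using compact_imp_bounded[OF c] unfolding bounded_pos by blast
  show ?thesis
  proof
    show "norm (\<phi> x) \<le> B" for x
      using B not_in_supp[of x \<phi>] by (cases "x \<in> supp \<phi>") auto
    show "\<phi> x = 0" if "norm x > r" for x
      using r(2) not_in_supp[of x \<phi>] that by fastforce
  qed (use B r in auto)
qed

lemma locally_integrable_times_test_function:
  fixes f :: "real^'n \<Rightarrow> complex"
  assumes f: "f locally_integrable_on UNIV" and "\<phi> \<in> test_functions"
  shows "integrable lebesgue (\<lambda>x. f x * \<phi> x)"
proof -
  obtain B r where Br: "B > 0" "r > 0" "\<And>x. norm (\<phi> x) \<le> B" "\<And>x. norm x > r \<Longrightarrow> \<phi> x = 0"
    using test_function_bounded[OF assms(2)] by blast
  have "set_integrable lebesgue (cball 0 r) f"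
    using f by (simp add: locally_integrable_on_def lebesgue_on_UNIV_eq)
  then have i: "integrable lebesgue (\<lambda>x. B *\<^sub>R (indicator (cball 0 r) x *\<^sub>R f x))"
    unfolding set_integrable_def by (intro integrable_scaleR_right)
  have fm: "f \<in> borel_measurable lebesgue"
    using f by (simp add: locally_integrable_on_def lebesgue_on_UNIV_eq)
  have "\<phi> \<in> borel_measurable borel"
    using assms(2) by (simp add: test_functions_def smooth_measurable)
  then have pm: "\<phi> \<in> borel_measurable lebesgue"
    by (simp add: measurable_completion)
  show ?thesis
  proof (rule Bochner_Integration.integrable_bound[OF i])
    show "(\<lambda>x. f x * \<phi> x) \<in> borel_measurable lebesgue" using fm pm by simp
    have "norm (f x * \<phi> x) \<le> norm (B *\<^sub>R (indicator (cball 0 r) x *\<^sub>R f x))" for x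
    proof (cases "norm x > r")
      case False
      then show ?thesis using Br(1) mult_right_mono[OF Br(3)[of x], of "norm (f x)"]
        by (simp add: norm_mult mult.commute)
    qed (simp add: Br)
    then show "AE x in lebesgue. norm (f x * \<phi> x) \<le> norm (B *\<^sub>R (indicator (cball 0 r) x *\<^sub>R f x))"
      by simp
  qed
qed

text \<open>Lebesgue differentiation: outside a negligible set, the averages over cubes with lower
  corner \<open>x\<close> tend to \<open>f x\<close>, and all of these averages vanish.\<close>

lemma AE_zero_of_integral_box_zero:
  fixes f :: "'a::euclidean_space \<Rightarrow> 'b::euclidean_space"
  assumes "\<And>a b. f integrable_on cbox a b"
    and zero: "\<And>x h. h > 0 \<Longrightarrow> integral (cbox x (x + h *\<^sub>R One)) f = 0"
  shows "AE x in lebesgue. f x = 0"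
proof -
  obtain N where N: "negligible N" and lim: "\<And>x e. \<lbrakk>x \<notin> N; 0 < e\<rbrakk> \<Longrightarrow> \<exists>d>0. \<forall>h. 0 < h \<and> h < d \<longrightarrow>
      norm(integral (cbox x (x + h *\<^sub>R One)) f /\<^sub>R h ^ DIM('a) - f x) < e"
    using integrable_ccontinuous_explicit[OF assms(1)] by blast
  have "f x = 0" if x: "x \<notin> N" for x
  proof (rule ccontr)
    assume "f x \<noteq> 0"
    then obtain d where d: "d > 0" "\<And>h. 0 < h \<and> h < d \<Longrightarrow>
      norm(integral (cbox x (x + h *\<^sub>R One)) f /\<^sub>R h ^ DIM('a) - f x) < norm (f x)"
      using lim[OF x, of "norm (f x)"] by auto
    show False using d(2)[of "d/2"] d(1) by (simp add: zero)
  qed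
  then have "{x. f x \<noteq> 0} \<subseteq> N" by blast
  then have "negligible {x. f x \<noteq> 0}" using N negligible_subset by blast
  then show ?thesis
    by (intro AE_I'[of "{x. f x \<noteq> 0}"]) (auto simp: negligible_iff_null_sets)
qed

text \<open>This is needed because \<open>has_hausdorff\<close> only provides some representative
  \<open>f\<close> of a distribution; here it is identified almost everywhere with the intended one.
  Indicators of boxes are not test functions, so they are reached as dominated limits of box
  bumps.\<close>

lemma fun_distr_inject_AE:
  fixes f g :: "real^'n \<Rightarrow> complex"
  assumes f: "f locally_integrable_on UNIV" and g: "g locally_integrable_on UNIV"
    and eq: "fun_distr f = fun_distr g"
  shows "AE x in lebesgue. f x = g x"
proof -
  define d where "d = (\<lambda>x. f x - g x)"
  have di: "set_integrable lebesgue K d" if "compact K" for K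
    using f g that by (auto simp: locally_integrable_on_def d_def intro: set_integral_diff)
  have dm: "d \<in> borel_measurable lebesgue"
    using f g unfolding d_def by (intro borel_measurable_diff) (auto simp: locally_integrable_on_def lebesgue_on_UNIV_eq)
  have test: "(LINT x|lebesgue. d x * \<phi> x) = 0" if "\<phi> \<in> test_functions" for \<phi>
  proof -
    have "(LINT x|lebesgue. d x * \<phi> x) = (LINT x|lebesgue. f x * \<phi> x - g x * \<phi> x)"
      by (simp add: d_def algebra_simps)
    also have "\<dots> = (LINT x|lebesgue. f x * \<phi> x) - (LINT x|lebesgue. g x * \<phi> x)"
      using that f g by (intro Bochner_Integration.integral_diff locally_integrable_times_test_function)
    also have "\<dots> = 0" using fun_cong[OF eq, of \<phi>] that by (simp add: fun_distr_def)
    finally show ?thesis .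
  qed
  have box: "integral (cbox a b) d = 0" if ab: "\<And>i. a $ i < b $ i" for a b
  proof -
    have "(\<lambda>k. LINT x|lebesgue. d x * of_real (box_bump (real (Suc k)) a b x))
        \<longlonglongrightarrow> (LINT x|lebesgue. d x * of_real (indicator (box a b) x))"
    proof (rule integral_dominated_convergence[where w = "\<lambda>x. norm (indicator (cbox a b) x *\<^sub>R d x)"])
      show "integrable lebesgue (\<lambda>x. norm (indicator (cbox a b) x *\<^sub>R d x))"
        using di[of "cbox a b"] unfolding set_integrable_def by (intro integrable_norm) simp
      have "(\<lambda>x. complex_of_real (box_bump (real (Suc k)) a b x)) \<in> borel_measurable lebesgue" for k
        using box_bump_test_function[OF ab, where k = "real (Suc k)"]
        by (intro measurable_completion) (simp add: test_functions_def smooth_measurable)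
      then show "(\<lambda>x. d x * complex_of_real (box_bump (real (Suc k)) a b x)) \<in> borel_measurable lebesgue" for k
        using dm by simp
      have "box a b \<in> sets lebesgue" by simp
      then have "(\<lambda>x. complex_of_real (indicator (box a b) x)) \<in> borel_measurable lebesgue"
        by measurable
      then show "(\<lambda>x. d x * complex_of_real (indicator (box a b) x)) \<in> borel_measurable lebesgue"
        using dm by simp
      show "AE x in lebesgue. (\<lambda>k. d x * complex_of_real (box_bump (real (Suc k)) a b x))
          \<longlonglongrightarrow> d x * complex_of_real (indicator (box a b) x)"
        by (intro AE_I2 tendsto_mult tendsto_const tendsto_of_real box_bump_tendsto ab)
      show "AE x in lebesgue. norm (d x * complex_of_real (box_bump (real (Suc k)) a b x))
          \<le> norm (indicator (cbox a b) x *\<^sub>R d x)" for k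
      proof (rule AE_I2)
        fix x
        show "norm (d x * complex_of_real (box_bump (real (Suc k)) a b x))
          \<le> norm (indicator (cbox a b) x *\<^sub>R d x)"
        proof (cases "x \<in> box a b")
          case True
          then have "x \<in> cbox a b" using box_subset_cbox by blast
          then show ?thesis
            by (simp add: norm_mult box_bump_nonneg mult_left_le box_bump_le_1)
        next
          case False
          then show ?thesis using box_bump_eq_0[OF False ab, where k = "real (Suc k)"] by simp
        qed
      qed
    qed
    moreover have "(LINT x|lebesgue. d x * of_real (box_bump (real (Suc k)) a b x)) = 0" for k
      by (rule test) (rule box_bump_test_function, use ab in auto)
    ultimately have "(LINT x|lebesgue. d x * of_real (indicator (box a b) x)) = 0"
      by (simp add: LIMSEQ_const_iff)
    then have "(LINT x:box a b|lebesgue. d x) = 0"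
      by (simp add: set_lebesgue_integral_def scaleR_conv_of_real mult.commute)
    moreover have "set_integrable lebesgue (box a b) d"
      using di[of "cbox a b"] set_integrable_subset[of lebesgue "cbox a b" d "box a b"] box_subset_cbox by auto
    ultimately show ?thesis
      using set_lebesgue_integral_eq_integral(2)[of "box a b" d] by (simp add: integral_open_interval)
  qed
  have "AE x in lebesgue. d x = 0"
  proof (rule AE_zero_of_integral_box_zero)
    show "d integrable_on cbox a b" for a b
      by (intro set_lebesgue_integral_eq_integral(1) di) simp
    show "integral (cbox x (x + h *\<^sub>R One)) d = 0" if "h > 0" for x h
      using that by (intro box) (simp add: cart_eq_inner_axis inner_add_left axis_in_Basis_iff)
  qed
  then show ?thesis by (simp add: d_def)
qed

lemma foldr_dir_deriv_eq_0:
  assumes "smooth f" "x \<notin> supp f"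
  shows "foldr dir_deriv vs f x = 0"
  using assms(2)
proof (induction vs arbitrary: x)
  case (Cons v vs)
  have "frechet_derivative (foldr dir_deriv vs f) (at x) = frechet_derivative (\<lambda>x. 0) (at x)"
  proof (rule frechet_derivative_transform_within_open)
    show "foldr dir_deriv vs f differentiable at x" using assms(1) by (simp add: smooth_def)
    show "open (- supp f)" by (simp add: supp_def open_Compl)
  qed (use Cons in auto)
  then show ?case by (simp add: dir_deriv_def[of v])
qed (simp add: not_in_supp)

lemma distribution_diff:
  assumes u: "u \<in> distributions" and "\<phi> \<in> test_functions" "\<psi> \<in> test_functions"
    and "(\<lambda>x. \<phi> x - \<psi> x) \<in> test_functions"
  shows "u (\<lambda>x. \<phi> x - \<psi> x) = u \<phi> - u \<psi>"
proof -
  have "\<forall>\<phi>\<in>test_functions. \<forall>\<psi>\<in>test_functions. u (\<lambda>x. \<phi> x + \<psi> x) = u \<phi> + u \<psi>"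
    using u unfolding distributions_def by simp
  from bspec[OF bspec[OF this assms(4)] assms(3)]
  have "u (\<lambda>x. (\<phi> x - \<psi> x) + \<psi> x) = u (\<lambda>x. \<phi> x - \<psi> x) + u \<psi>" .
  then show ?thesis by simp
qed

text \<open>Every derivative of \<open>g (r \<cdot>)\<close> converges uniformly as \<open>r \<rightarrow> r\<^sub>0\<close>, so that dilation is
  continuous into the test functions.\<close>

lemma distribution_dilation_continuous:
  fixes u :: "'n::finite functional"
  assumes u: "u \<in> distributions" and g: "g \<in> test_functions"
  shows "continuous_on {0<..} (\<lambda>r::real. u (\<lambda>x. g (r *\<^sub>R x)))"
proof (rule continuous_at_imp_continuous_on, rule ballI)
  fix r0 :: real assume "r0 \<in> {0<..}"
  then have r0: "r0 > 0" by simp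
  have sg: "smooth g" using g by (simp add: test_functions_def)
  obtain B where B: "B > 0" "\<And>x. x \<in> supp g \<Longrightarrow> norm x \<le> B"
    using g compact_imp_bounded[of "supp g"] unfolding test_functions_def bounded_pos by blast
  \<comment> \<open>The continuity estimate of a distribution is tied to one compact set. For
    \<open>r \<ge> r0 / 2\<close> the support of \<open>g (r \<cdot>)\<close> lies in the ball of
    radius \<open>B / r \<le> 2 * B / r0\<close>, so \<open>K\<close> serves all \<open>r\<close> in
    \<open>I\<close> at once.\<close>
  define K where "K = cball (0::real^'n) (2 * B / r0)"
  define I where "I = {r0/2..2*r0}"
  have out: "r *\<^sub>R x \<notin> supp g" if "r \<in> I" "x \<notin> K" for r x
  proof
    assume "r *\<^sub>R x \<in> supp g"
    then have "r * norm x \<le> B" using B(2)[of "r *\<^sub>R x"] that r0 by (simp add: I_def)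
    moreover have "r0 / 2 * norm x \<le> r * norm x"
      using that by (intro mult_right_mono) (auto simp: I_def)
    ultimately show False using that r0 by (simp add: K_def field_simps)
  qed
  have sm: "smooth (\<lambda>x. g (r *\<^sub>R x))" for r using smooth_affine[OF sg, of 0 r] by simp
  define D where "D = (\<lambda>r x. g (r *\<^sub>R x) - g (r0 *\<^sub>R x))"
  have r0I: "r0 \<in> I" using r0 by (simp add: I_def)
  have D0: "D r x = 0" if "r \<in> I" "x \<notin> K" for r x
    using out[OF that] out[OF r0I that(2)] by (simp add: D_def not_in_supp)
  have Dt: "D r \<in> test_functions" if "r \<in> I" for r
  proof (rule test_functionI[of _ K])
    show "smooth (D r)" unfolding D_def by (intro smooth_diff sm)
  qed (use D0[OF that] in \<open>auto simp: K_def\<close>)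
  have Ds: "supp (D r) \<subseteq> K" if "r \<in> I" for r
    using D0[OF that] by (intro supp_subsetI) (auto simp: K_def)
  obtain C m where C: "\<And>\<phi>. \<phi> \<in> test_functions \<Longrightarrow> supp \<phi> \<subseteq> K \<Longrightarrow>
        norm (u \<phi>) \<le> C * (\<Sum>vs | set vs \<subseteq> Basis \<and> length vs \<le> m. SUP x. norm (foldr dir_deriv vs \<phi> x))"
  proof -
    have "\<exists>C m. \<forall>\<phi>\<in>test_functions. supp \<phi> \<subseteq> K \<longrightarrow>
        norm (u \<phi>) \<le> C * (\<Sum>vs | set vs \<subseteq> Basis \<and> length vs \<le> m. SUP x. norm (foldr dir_deriv vs \<phi> x))"
      using u unfolding distributions_def by (simp add: K_def)
    then show ?thesis using that by blast
  qed
  have IE: "eventually (\<lambda>r. r \<in> I) (at r0)"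
    unfolding I_def using r0 eventually_at_in_open'[of "{r0/2<..<2*r0}" r0]
    by (auto elim!: eventually_mono)
  have S: "((\<lambda>r. SUP x. norm (foldr dir_deriv vs (D r) x)) \<longlongrightarrow> 0) (at r0)" for vs
  proof (rule tendstoI)
    fix e :: real assume e: "e > 0"
    \<comment> \<open>\<open>F (r, x)\<close> is the iterated derivative of
      \<open>g (r \<cdot>)\<close> at \<open>x\<close>. Joint continuity on the compact product
      \<open>I \<times> K\<close> becomes uniform continuity, hence closeness uniform in
      \<open>x\<close>.\<close>
    define F where "F = (\<lambda>p::real \<times> (real^'n). of_real (fst p) ^ length vs * foldr dir_deriv vs g (fst p *\<^sub>R snd p))"
    have "continuous_on (I \<times> K) F"
      unfolding F_def
      by (intro continuous_intros continuous_on_compose2[OF foldr_dir_deriv_continuous[OF sg, of UNIV]]) auto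
    moreover have "compact (I \<times> K)" by (simp add: I_def K_def compact_Times)
    ultimately have "uniformly_continuous_on (I \<times> K) F" by (rule compact_uniformly_continuous)
    then obtain d where d: "d > 0" "\<And>p q. p \<in> I \<times> K \<Longrightarrow> q \<in> I \<times> K \<Longrightarrow> dist p q < d \<Longrightarrow> dist (F p) (F q) < e/2"
      unfolding uniformly_continuous_on_def using e by (meson half_gt_zero)
    have "eventually (\<lambda>r. dist r r0 < d) (at r0)" using d(1) by (auto simp: eventually_at)
    then show "eventually (\<lambda>r. dist (SUP x. norm (foldr dir_deriv vs (D r) x)) 0 < e) (at r0)"
      using IE
    proof eventually_elim
      case (elim r)
      have b: "norm (foldr dir_deriv vs (D r) x) \<le> e/2" for x
      proof -
        have eq: "foldr dir_deriv vs (D r) x = F (r, x) - F (r0, x)"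
          using foldr_dir_deriv_diff[OF sm[of r] sm[of r0]] foldr_dir_deriv_affine[OF sg, of vs 0]
          by (simp add: D_def F_def)
        show ?thesis
        proof (cases "x \<in> K")
          case True
          have "dist (F (r, x)) (F (r0, x)) < e/2"
            using elim True r0I by (intro d(2)) (auto simp: dist_Pair_Pair)
          then show ?thesis by (simp add: eq dist_norm)
        next
          case False
          then show ?thesis using out[OF elim(2) False] out[OF r0I False] e
            by (simp add: eq F_def foldr_dir_deriv_eq_0[OF sg])
        qed
      qed
      then have "(SUP x. norm (foldr dir_deriv vs (D r) x)) \<le> e/2"
        by (intro cSUP_least) auto
      moreover have "0 \<le> (SUP x. norm (foldr dir_deriv vs (D r) x))"
        by (rule cSUP_upper2[where x = 0]) (use b in \<open>auto intro!: bdd_aboveI[of _ "e/2"] simp del: le_divide_eq_numeral1\<close>)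
      ultimately show ?case using e by simp
    qed
  qed
  have "((\<lambda>r. C * (\<Sum>vs | set vs \<subseteq> Basis \<and> length vs \<le> m. SUP x. norm (foldr dir_deriv vs (D r) x)))
      \<longlongrightarrow> C * (\<Sum>vs | set vs \<subseteq> (Basis::(real^'n) set) \<and> length vs \<le> m. 0)) (at r0)"
    by (intro tendsto_mult tendsto_const tendsto_sum S)
  then have lim: "((\<lambda>r. C * (\<Sum>vs | set vs \<subseteq> Basis \<and> length vs \<le> m. SUP x. norm (foldr dir_deriv vs (D r) x)))
      \<longlongrightarrow> 0) (at r0)" by simp
  have "((\<lambda>r. u (\<lambda>x. g (r *\<^sub>R x)) - u (\<lambda>x. g (r0 *\<^sub>R x))) \<longlongrightarrow> 0) (at r0)"
  proof (rule Lim_null_comparison[OF _ lim])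
    show "\<forall>\<^sub>F r in at r0. norm (u (\<lambda>x. g (r *\<^sub>R x)) - u (\<lambda>x. g (r0 *\<^sub>R x)))
        \<le> C * (\<Sum>vs | set vs \<subseteq> Basis \<and> length vs \<le> m. SUP x. norm (foldr dir_deriv vs (D r) x))"
      using IE
    proof eventually_elim
      case (elim r)
      have "r > 0" using elim r0 by (simp add: I_def)
      then have "u (D r) = u (\<lambda>x. g (r *\<^sub>R x)) - u (\<lambda>x. g (r0 *\<^sub>R x))"
        unfolding D_def using test_function_affine[OF g, of _ 0] r0 Dt[OF elim] u
        by (intro distribution_diff) (auto simp: D_def)
      then show ?case using C[OF Dt[OF elim] Ds[OF elim]] by simp
    qed
  qed
  then show "isCont (\<lambda>r. u (\<lambda>x. g (r *\<^sub>R x))) r0"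
    unfolding isCont_def by (rule LIM_zero_cancel)
qed

subsection \<open>Integrals against radial functions\<close>

text \<open>The positive and the negative part of \<open>h\<close>, pushed forward along
  \<open>norm\<close>, are finite measures on the line. The hypothesis says that they agree on all
  open upper half-lines; hence they coincide, and \<open>G\<close> has the same integral against
  both.\<close>

lemma radial_integral_zero_real:
  fixes h :: "'a::euclidean_space \<Rightarrow> real" and G :: "real \<Rightarrow> complex"
  assumes h: "integrable lborel h"
    and zero: "\<And>c. (LINT y|lborel. h y * indicator {c<..} (norm y)) = 0"
    and G[measurable]: "G \<in> borel_measurable borel"
    and hG: "integrable lborel (\<lambda>y. of_real (h y) * G (norm y))"
  shows "(LINT y|lborel. of_real (h y) * G (norm y)) = 0"
proof -
  have [measurable]: "h \<in> borel_measurable borel" using h by auto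
  \<comment> \<open>The values \<open>s = 1\<close> and \<open>s = - 1\<close> give the images of
    the positive and the negative part of \<open>h\<close>.\<close>
  define P where "P s = distr (density lborel (\<lambda>y. ennreal (max 0 (s * h y)))) borel norm" for s :: real
  have int: "integrable lborel (\<lambda>y. max 0 (s * h y))" for s
    using h by (intro integrable_max integrable_mult_right) auto
  have em: "emeasure (P s) {c<..} = ennreal (LINT y|lborel. max 0 (s * h y) * indicator {c<..} (norm y))" for s c
  proof -
    have "emeasure (P s) {c<..} = (\<integral>\<^sup>+y. ennreal (max 0 (s * h y)) * indicator (norm -` {c<..}) y \<partial>lborel)"
    proof -
      have "norm -` {c<..} \<inter> space (lborel :: 'a measure) \<in> sets lborel"
        by (rule measurable_sets[of norm lborel borel]) auto
      then have "norm -` {c<..} \<in> sets (borel :: 'a measure)" by simp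
      then show ?thesis
        unfolding P_def by (subst emeasure_distr) (auto simp: emeasure_density)
    qed
    also have "\<dots> = (\<integral>\<^sup>+y. ennreal (max 0 (s * h y) * indicator {c<..} (norm y)) \<partial>lborel)"
      by (intro nn_integral_cong) (auto simp: indicator_def)
    also have "\<dots> = ennreal (LINT y|lborel. max 0 (s * h y) * indicator {c<..} (norm y))"
    proof (rule nn_integral_eq_integral)
      show "integrable lborel (\<lambda>y. max 0 (s * h y) * indicator {c<..} (norm y))"
        by (rule Bochner_Integration.integrable_bound[OF int[of s]]) (auto simp: indicator_def)
    qed auto
    finally show ?thesis .
  qed
  have "P 1 = P (- 1)"
  proof (rule measure_eqI_lessThan)
    show "emeasure (P 1) {c<..} = emeasure (P (- 1)) {c<..}" for c
    proof -
      have i: "integrable lborel (\<lambda>y. max 0 (s * h y) * indicator {c<..} (norm y))" for s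
        by (rule Bochner_Integration.integrable_bound[OF int[of s]]) (auto simp: indicator_def)
      have "(LINT y|lborel. max 0 (1 * h y) * indicator {c<..} (norm y)) -
          (LINT y|lborel. max 0 (-1 * h y) * indicator {c<..} (norm y)) =
          (LINT y|lborel. max 0 (1 * h y) * indicator {c<..} (norm y) - max 0 (-1 * h y) * indicator {c<..} (norm y))"
        by (rule Bochner_Integration.integral_diff[symmetric]) (rule i)+
      also have "\<dots> = (LINT y|lborel. h y * indicator {c<..} (norm y))"
        by (intro Bochner_Integration.integral_cong) (auto simp: indicator_def max_def)
      finally show ?thesis unfolding em by (simp add: zero)
    qed
    show "emeasure (P 1) {c<..} < \<infinity>" for c unfolding em by simp
  qed (auto simp: P_def)
  moreover have "(LINT r|P s. G r) = (LINT y|lborel. max 0 (s * h y) *\<^sub>R G (norm y))" for s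
    unfolding P_def by (subst integral_distr) (auto simp: integral_density)
  ultimately have "(LINT y|lborel. max 0 (1 * h y) *\<^sub>R G (norm y)) = (LINT y|lborel. max 0 (-1 * h y) *\<^sub>R G (norm y))"
    by metis
  moreover have i: "integrable lborel (\<lambda>y. max 0 (s * h y) *\<^sub>R G (norm y))" if "\<bar>s\<bar> = 1" for s
  proof (rule Bochner_Integration.integrable_bound[OF hG])
    have "max 0 (s * h y) \<le> \<bar>h y\<bar>" for y using that by (auto simp: abs_if split: if_splits)
    then show "AE y in lborel. norm (max 0 (s * h y) *\<^sub>R G (norm y)) \<le> norm (of_real (h y) * G (norm y))"
      by (auto simp: norm_mult intro!: mult_right_mono)
  qed measurable
  ultimately have "(LINT y|lborel. max 0 (1 * h y) *\<^sub>R G (norm y) - max 0 (-1 * h y) *\<^sub>R G (norm y)) = 0"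
    using Bochner_Integration.integral_diff[OF i[of 1] i[of "-1"]] by simp
  also have "(LINT y|lborel. max 0 (1 * h y) *\<^sub>R G (norm y) - max 0 (-1 * h y) *\<^sub>R G (norm y)) =
      (LINT y|lborel. of_real (h y) * G (norm y))"
    by (intro Bochner_Integration.integral_cong) (auto simp: max_def scaleR_conv_of_real)
  finally show ?thesis .
qed

text \<open>On a fixed annulus the weight \<open>norm y ^ m\<close> can be divided out of the radial
  factor, since \<open>norm y\<close> is bounded away from 0. Convergence of the full integral then
  allows exhausting the space by annuli.\<close>

lemma radial_integral_zero:
  fixes \<Phi> :: "'a::euclidean_space \<Rightarrow> complex" and G :: "real \<Rightarrow> complex"
  assumes [measurable]: "\<Phi> \<in> borel_measurable borel" "G \<in> borel_measurable borel"
    and loc: "\<And>a b. 0 < a \<Longrightarrow> integrable lborel (\<lambda>y. indicator {a..b} (norm y) *\<^sub>R \<Phi> y)"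
    and zero: "\<And>a b. 0 < a \<Longrightarrow> a < b \<Longrightarrow>
      (LINT y|lborel. indicator {a<..<b} (norm y) *\<^sub>R (norm y ^ m *\<^sub>R \<Phi> y)) = 0"
    and \<Phi>G: "integrable lborel (\<lambda>y. \<Phi> y * G (norm y))"
  shows "(LINT y|lborel. \<Phi> y * G (norm y)) = 0"
proof -
  have ind: "(LINT y|lborel. indicator {a<..<b} (norm y) *\<^sub>R (\<Phi> y * G (norm y))) = 0" if a: "0 < a" for a b
  proof -
    define H where "H = (\<lambda>y. indicator {a<..<b} (norm y) *\<^sub>R (norm y ^ m *\<^sub>R \<Phi> y))"
    have Hm[measurable]: "H \<in> borel_measurable borel" unfolding H_def by measurable
    have Hi: "integrable lborel H"
    proof (rule Bochner_Integration.integrable_bound)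
      show "integrable lborel (\<lambda>y. b ^ m *\<^sub>R (indicator {a..b} (norm y) *\<^sub>R \<Phi> y))"
        by (intro integrable_scaleR_right loc a)
      show "AE y in lborel. norm (H y) \<le> norm (b ^ m *\<^sub>R (indicator {a..b} (norm y) *\<^sub>R \<Phi> y))"
        using a by (auto simp: H_def indicator_def intro!: AE_I2 mult_right_mono power_mono)
    qed auto
    \<comment> \<open>Cutting an annulus by a half-line in the radius leaves an annulus or the empty
      set.\<close>
    have Hz: "(LINT y|lborel. indicator {c<..} (norm y) *\<^sub>R H y) = 0" for c
    proof (cases "max a c < b")
      case True
      have "(LINT y|lborel. indicator {c<..} (norm y) *\<^sub>R H y) =
          (LINT y|lborel. indicator {max a c<..<b} (norm y) *\<^sub>R (norm y ^ m *\<^sub>R \<Phi> y))"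
        by (intro Bochner_Integration.integral_cong) (auto simp: H_def indicator_def)
      then show ?thesis using zero[of "max a c" b] a True by simp
    next
      case False
      then have *: "indicator {c<..} (norm y) *\<^sub>R H y = 0" for y
        by (auto simp: H_def indicator_def)
      show ?thesis unfolding * by simp
    qed
    have iH: "integrable lborel (\<lambda>y. indicator {c<..} (norm y) *\<^sub>R H y)" for c
      by (rule Bochner_Integration.integrable_bound[OF Hi]) (auto simp: indicator_def)
    define G' where "G' = (\<lambda>r::real. G r / of_real (r ^ m) * indicator {a<..<b} r)"
    have [measurable]: "G' \<in> borel_measurable borel" unfolding G'_def by measurable
    have HG: "H y * G' (norm y) = indicator {a<..<b} (norm y) *\<^sub>R (\<Phi> y * G (norm y))" for y
      using a by (auto simp: H_def G'_def indicator_def scaleR_conv_of_real)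
    have iHG: "integrable lborel (\<lambda>y. H y * G' (norm y))"
      by (rule Bochner_Integration.integrable_bound[OF \<Phi>G]) (auto simp: HG indicator_def)
    \<comment> \<open>The measure argument handles real densities only, so the density is split into
      real and imaginary part while the radial factor stays complex.\<close>
    have part: "integrable lborel (\<lambda>y. of_real (T (H y)) * G' (norm y)) \<and>
        (LINT y|lborel. of_real (T (H y)) * G' (norm y)) = 0" if T: "T = Re \<or> T = Im" for T
    proof -
      have bl: "bounded_linear T" using T bounded_linear_Re bounded_linear_Im by auto
      have Tm[measurable]: "(\<lambda>y. T (H y)) \<in> borel_measurable borel"
        using T by auto
      have Tb: "\<bar>T z\<bar> \<le> norm z" for z using T abs_Re_le_cmod abs_Im_le_cmod by auto
      have i: "integrable lborel (\<lambda>y. of_real (T (H y)) * G' (norm y))"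
        by (rule Bochner_Integration.integrable_bound[OF iHG]) (auto simp: norm_mult intro!: mult_right_mono Tb)
      have "(LINT y|lborel. T (H y) * indicator {c<..} (norm y)) = 0" for c
      proof -
        have "(LINT y|lborel. T (indicator {c<..} (norm y) *\<^sub>R H y)) = T (LINT y|lborel. indicator {c<..} (norm y) *\<^sub>R H y)"
          by (rule integral_bounded_linear[OF bl iH])
        also have "\<dots> = 0" unfolding Hz using bl by (simp add: linear_simps)
        finally show ?thesis
          using linear_simps(5)[OF bl] by (simp add: mult.commute)
      qed
      from radial_integral_zero_real[OF _ this _ i] i show ?thesis
        using integrable_bounded_linear[OF bl Hi] by simp
    qed
    have "(LINT y|lborel. H y * G' (norm y)) =
        (LINT y|lborel. of_real (Re (H y)) * G' (norm y) + \<i> * (of_real (Im (H y)) * G' (norm y)))"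
    proof (intro Bochner_Integration.integral_cong refl)
      fix y
      have "H y = of_real (Re (H y)) + \<i> * of_real (Im (H y))" by (simp add: complex_eq)
      then show "H y * G' (norm y) = of_real (Re (H y)) * G' (norm y) + \<i> * (of_real (Im (H y)) * G' (norm y))"
        by (metis distrib_right mult.assoc)
    qed
    also have "\<dots> = 0"
      using part[of Re] part[of Im] by (subst Bochner_Integration.integral_add) auto
    finally show ?thesis unfolding HG .
  qed
  have "(\<lambda>k. LINT y|lborel. indicator {1 / real (Suc k)<..<real (Suc k)} (norm y) *\<^sub>R (\<Phi> y * G (norm y)))
      \<longlonglongrightarrow> (LINT y|lborel. \<Phi> y * G (norm y))"
  proof (rule integral_dominated_convergence[where w = "\<lambda>y. norm (\<Phi> y * G (norm y))"])
    show "AE y in lborel. (\<lambda>k. indicator {1 / real (Suc k)<..<real (Suc k)} (norm y) *\<^sub>R (\<Phi> y * G (norm y)))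
        \<longlonglongrightarrow> \<Phi> y * G (norm y)"
    proof (rule AE_mp[OF AE_lborel_singleton[of 0]], rule AE_I2, rule impI)
      fix y :: 'a assume "y \<noteq> 0"
      then have y: "norm y > 0" by simp
      have "(\<lambda>k. 1 / real (Suc k)) \<longlonglongrightarrow> 0" by real_asymp
      then have "eventually (\<lambda>k. 1 / real (Suc k) < norm y) sequentially"
        using y by (rule order_tendstoD)
      moreover have "filterlim (\<lambda>k. real (Suc k)) at_top sequentially" by real_asymp
      then have "eventually (\<lambda>k. norm y < real (Suc k)) sequentially"
        by (simp add: filterlim_at_top_dense)
      ultimately have "eventually (\<lambda>k. indicator {1 / real (Suc k)<..<real (Suc k)} (norm y) *\<^sub>R (\<Phi> y * G (norm y)) = \<Phi> y * G (norm y)) sequentially"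
        by eventually_elim simp
      then show "(\<lambda>k. indicator {1 / real (Suc k)<..<real (Suc k)} (norm y) *\<^sub>R (\<Phi> y * G (norm y)))
          \<longlonglongrightarrow> \<Phi> y * G (norm y)" by (rule tendsto_eventually)
    qed
  qed (use \<Phi>G in \<open>auto simp: indicator_def\<close>)
  then show ?thesis by (simp add: ind LIMSEQ_const_iff)
qed

subsection \<open>The kernel of a convolved dilated bump\<close>

lemma
  fixes f :: "'a::euclidean_space \<Rightarrow> 'b::{banach, second_countable_topology}"
  assumes [measurable]: "f \<in> borel_measurable borel" and c: "c \<noteq> 0"
  shows lborel_integrable_affine: "integrable lborel f \<Longrightarrow> integrable lborel (\<lambda>x. f (t + c *\<^sub>R x))"
    and lborel_integral_affine: "(LINT x|lborel. f (t + c *\<^sub>R x)) = (LINT x|lborel. f x) /\<^sub>R \<bar>c\<bar> ^ DIM('a)"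
proof -
  have dens: "(lborel :: 'a measure) = density (distr lborel borel (\<lambda>x. t + c *\<^sub>R x)) (\<lambda>_. ennreal (\<bar>c\<bar> ^ DIM('a)))"
    by (rule lborel_affine[OF c])
  have "integrable lborel f \<longleftrightarrow> integrable lborel (\<lambda>x. \<bar>c\<bar> ^ DIM('a) *\<^sub>R f (t + c *\<^sub>R x))"
    by (subst dens, subst integrable_density) (auto simp: integrable_distr_eq)
  then show "integrable lborel (\<lambda>x. f (t + c *\<^sub>R x))" if "integrable lborel f"
    using c that integrable_scaleR_right[of "1 / \<bar>c\<bar> ^ DIM('a)" lborel "\<lambda>x. \<bar>c\<bar> ^ DIM('a) *\<^sub>R f (t + c *\<^sub>R x)"]
    by simp
  have "(LINT x|lborel. f x) = (LINT x|lborel. \<bar>c\<bar> ^ DIM('a) *\<^sub>R f (t + c *\<^sub>R x))"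
    by (subst dens, subst integral_density) (auto simp: integral_distr)
  then show "(LINT x|lborel. f (t + c *\<^sub>R x)) = (LINT x|lborel. f x) /\<^sub>R \<bar>c\<bar> ^ DIM('a)"
    using c by simp
qed

lemma nn_integral_lborel_affine:
  fixes f :: "'a::euclidean_space \<Rightarrow> ennreal"
  assumes [measurable]: "f \<in> borel_measurable borel" and c: "c \<noteq> 0"
  shows "(\<integral>\<^sup>+x. f x \<partial>lborel) = ennreal (\<bar>c\<bar> ^ DIM('a)) * (\<integral>\<^sup>+x. f (t + c *\<^sub>R x) \<partial>lborel)"
proof -
  have dens: "(lborel :: 'a measure) = density (distr lborel borel (\<lambda>x. t + c *\<^sub>R x)) (\<lambda>_. ennreal (\<bar>c\<bar> ^ DIM('a)))"
    by (rule lborel_affine[OF c])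
  show ?thesis
    by (subst dens, subst nn_integral_density) (auto simp: nn_integral_distr nn_integral_cmult)
qed

lemma integrable_pair_product:
  fixes f :: "'a::euclidean_space \<Rightarrow> real" and g :: "'b::euclidean_space \<Rightarrow> real"
  assumes f: "integrable lborel f" and g: "integrable lborel g"
  shows "integrable (lborel \<Otimes>\<^sub>M lborel) (\<lambda>(x, y). f x * g y)"
proof -
  have [measurable]: "f \<in> borel_measurable borel" "g \<in> borel_measurable borel"
    using f g by auto
  show ?thesis
  proof (rule lborel_pair.Fubini_integrable)
    show "integrable lborel (\<lambda>x. LINT y|lborel. norm (case (x, y) of (x, y) \<Rightarrow> f x * g y))"
      using f by (simp add: abs_mult)
    show "AE x in lborel. integrable lborel (\<lambda>y. case (x, y) of (x, y) \<Rightarrow> f x * g y)"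
      using g by simp
  qed measurable
qed

section \<open>Volume of thin spherical shells\<close>

lemma power_diff_bound:
  fixes l u B :: real
  assumes "0 \<le> l" "l \<le> u" "u \<le> B"
  shows "u ^ n - l ^ n \<le> real n * B ^ (n - 1) * (u - l)"
proof -
  have "u ^ n - l ^ n = (u - l) * (\<Sum>i<n. l ^ (n - Suc i) * u ^ i)"
    by (rule power_diff_sumr2)
  also have "\<dots> \<le> (u - l) * (\<Sum>i<n. B ^ (n - 1))"
  proof (intro mult_left_mono sum_mono)
    fix i assume "i \<in> {..<n}"
    then have "n - 1 = (n - Suc i) + i" by auto
    then have "B ^ (n - 1) = B ^ (n - Suc i) * B ^ i" by (metis power_add)
    moreover have "l ^ (n - Suc i) * u ^ i \<le> B ^ (n - Suc i) * B ^ i"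
      using assms by (intro mult_mono power_mono) auto
    ultimately show "l ^ (n - Suc i) * u ^ i \<le> B ^ (n - 1)" by simp
  qed (use assms in auto)
  finally show ?thesis by (simp add: mult_ac)
qed

text \<open>The volume is linear in the thickness \<open>\<delta>\<close> for radii bounded by
  \<open>B\<close>. With thickness of order \<open>1 / R\<close> this is the source of the decay of
  the image.\<close>

lemma emeasure_annulus_le:
  fixes s \<delta> B :: real
  assumes "0 < \<delta>" "0 < B"
  shows "emeasure lborel {y::'a::euclidean_space. \<bar>norm y - s\<bar> \<le> \<delta> \<and> norm y \<le> B} \<le>
    ennreal (unit_ball_vol DIM('a) * (DIM('a) * B ^ (DIM('a) - 1) * (2 * \<delta>)))"
proof -
  define l u where "l = max 0 (s - \<delta>)" and "u = min B (s + \<delta>)"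
  show ?thesis
  proof (cases "l \<le> u")
    case False
    have empty: "{y::'a. \<bar>norm y - s\<bar> \<le> \<delta> \<and> norm y \<le> B} = {}"
    proof (intro equals0I)
      fix y :: 'a assume "y \<in> {y. \<bar>norm y - s\<bar> \<le> \<delta> \<and> norm y \<le> B}"
      then have "l \<le> norm y" "norm y \<le> u" by (auto simp: l_def u_def)
      then show False using False by simp
    qed
    show ?thesis unfolding empty by simp
  next
    case True
    have l0: "0 \<le> l" by (simp add: l_def)
    have sub: "{y::'a. \<bar>norm y - s\<bar> \<le> \<delta> \<and> norm y \<le> B} \<subseteq> cball 0 u - ball 0 l"
    proof
      fix y :: 'a assume "y \<in> {y. \<bar>norm y - s\<bar> \<le> \<delta> \<and> norm y \<le> B}"
      then have "l \<le> norm y" "norm y \<le> u" by (auto simp: l_def u_def)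
      then show "y \<in> cball 0 u - ball 0 l" by simp
    qed
    have "ball (0::'a) l \<subseteq> cball 0 u" using True by auto
    then have "emeasure lborel (cball (0::'a) u - ball 0 l) = emeasure lborel (cball (0::'a) u) - emeasure lborel (ball (0::'a) l)"
      by (intro emeasure_Diff) (auto simp: emeasure_ball l0)
    also have "\<dots> = ennreal (unit_ball_vol DIM('a) * (u ^ DIM('a) - l ^ DIM('a)))"
      using True l0 by (simp add: emeasure_ball emeasure_cball ennreal_minus right_diff_distrib)
    also have "\<dots> \<le> ennreal (unit_ball_vol DIM('a) * (DIM('a) * B ^ (DIM('a) - 1) * (2 * \<delta>)))"
    proof (intro ennreal_leI mult_left_mono)
      have "u ^ DIM('a) - l ^ DIM('a) \<le> DIM('a) * B ^ (DIM('a) - 1) * (u - l)"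
        using True l0 by (intro power_diff_bound) (auto simp: u_def)
      also have "\<dots> \<le> DIM('a) * B ^ (DIM('a) - 1) * (2 * \<delta>)"
        using assms by (intro mult_left_mono) (auto simp: u_def l_def)
      finally show "u ^ DIM('a) - l ^ DIM('a) \<le> DIM('a) * B ^ (DIM('a) - 1) * (2 * \<delta>)" .
    qed simp
    finally have "emeasure lborel (cball (0::'a) u - ball 0 l) \<le>
      ennreal (unit_ball_vol DIM('a) * (DIM('a) * B ^ (DIM('a) - 1) * (2 * \<delta>)))" .
    then show ?thesis
      by (intro order_trans[OF emeasure_mono[OF sub]]) auto
  qed
qed

section \<open>A bump, its translate in direction \<open>e\<close>, and the kernel of the convolved
  image\<close>

locale bump =
  fixes \<beta> :: "real^'n \<Rightarrow> real" and \<rho> :: real and e :: "real^'n"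
  assumes bump_measurable [measurable]: "\<beta> \<in> borel_measurable borel"
    and bump_nonneg: "0 \<le> \<beta> x" and bump_le_1: "\<beta> x \<le> 1"
    and radius_pos: "0 < \<rho>" and bump_support: "\<rho> < norm x \<Longrightarrow> \<beta> x = 0"
    and norm_e: "norm e = 1"
begin

definition mass :: real where
  "mass = (LINT x|lborel. \<beta> x)"

text \<open>The contribution of a single \<open>y\<close> with \<open>\<Phi> y\<close> taken as 1:
  the translated bump dilated by \<open>norm y\<close>, convolved with \<open>\<beta>\<close> and
  evaluated at \<open>x\<close>. It depends on \<open>y\<close> only through
  \<open>norm y\<close>.\<close>

definition kern :: "real \<Rightarrow> real^'n \<Rightarrow> real^'n \<Rightarrow> real" where
  "kern R x y = (LINT z|lborel. \<beta> (z /\<^sub>R norm y - R *\<^sub>R e) * \<beta> (x - z))"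

lemma bump_integrable: "integrable lborel \<beta>"
proof (rule Bochner_Integration.integrable_bound)
  show "integrable lborel (\<lambda>x. indicator (cball 0 \<rho>) x :: real)"
    by (simp add: emeasure_cball radius_pos less_imp_le)
  show "AE x in lborel. norm (\<beta> x) \<le> norm (indicator (cball 0 \<rho>) x :: real)"
    using bump_nonneg bump_le_1 bump_support by (auto simp: indicator_def not_le)
qed simp

lemma mass_nonneg: "0 \<le> mass"
  by (simp add: mass_def bump_nonneg)

lemma reflected_bump: "integrable lborel (\<lambda>z. \<beta> (x - z))" "(LINT z|lborel. \<beta> (x - z)) = mass"
  using lborel_integrable_affine[of \<beta> "-1" x] lborel_integral_affine[of \<beta> "-1" x] bump_integrable
  by (simp_all add: mass_def)

lemma kern_integrand_le: "\<beta> (z /\<^sub>R norm y - R *\<^sub>R e) * \<beta> (x - z) \<le> \<beta> (x - z)"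
  using bump_nonneg bump_le_1 by (simp add: mult_left_le_one_le)

lemma kern_integrand_integrable:
  "integrable lborel (\<lambda>z. \<beta> (z /\<^sub>R norm y - R *\<^sub>R e) * \<beta> (x - z))"
  by (rule Bochner_Integration.integrable_bound[OF reflected_bump(1)[of x]])
     (auto simp: abs_mult bump_nonneg kern_integrand_le)

lemma kern_nonneg: "0 \<le> kern R x y"
  by (simp add: kern_def bump_nonneg)

lemma kern_le: "kern R x y \<le> mass"
  unfolding kern_def reflected_bump(2)[of x, symmetric]
  by (intro integral_mono kern_integrand_integrable reflected_bump kern_integrand_le)

lemma kern_measurable [measurable]: "(\<lambda>(x, y). kern R x y) \<in> borel_measurable (borel \<Otimes>\<^sub>M borel)"
  unfolding kern_def by measurable

text \<open>The first factor puts \<open>z\<close> within \<open>\<rho> * norm y\<close> of the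
  point \<open>R * norm y\<close> on the ray through \<open>e\<close>, the second puts
  \<open>x\<close> within \<open>\<rho>\<close> of \<open>z\<close>; the two errors add up.\<close>

lemma kern_integrand_support:
  assumes "\<beta> (z /\<^sub>R norm y - R *\<^sub>R e) * \<beta> (x - z) \<noteq> 0" "\<rho> < R"
  shows "\<bar>norm x - R * norm y\<bar> \<le> \<rho> * (1 + norm y)" "y \<noteq> 0"
proof -
  have 1: "norm (z /\<^sub>R norm y - R *\<^sub>R e) \<le> \<rho>" "norm (x - z) \<le> \<rho>"
    using assms(1) bump_support by (fastforce simp: not_less[symmetric])+
  \<comment> \<open>At \<open>y = 0\<close> the inverse of the norm is 0 by convention, so the
    argument of the first factor is \<open>- R *\<^sub>R e\<close>, which lies outside the support
    because \<open>\<rho> < R\<close>.\<close>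
  show "y \<noteq> 0"
    using 1(1) assms(2) radius_pos by (auto simp: norm_e)
  then have "z - (R * norm y) *\<^sub>R e = norm y *\<^sub>R (z /\<^sub>R norm y - R *\<^sub>R e)"
    by (simp add: algebra_simps)
  then have "norm (z - (R * norm y) *\<^sub>R e) = norm y * norm (z /\<^sub>R norm y - R *\<^sub>R e)"
    by simp
  also have "\<dots> \<le> norm y * \<rho>" using 1(1) by (intro mult_left_mono) auto
  finally have "norm (z - (R * norm y) *\<^sub>R e) \<le> norm y * \<rho>" .
  moreover have "norm ((R * norm y) *\<^sub>R e) = R * norm y"
    using assms(2) radius_pos by (simp add: norm_e abs_mult)
  ultimately have "\<bar>norm z - R * norm y\<bar> \<le> norm y * \<rho>"
    using norm_triangle_ineq3[of z "(R * norm y) *\<^sub>R e"] by linarith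
  moreover have "\<bar>norm x - norm z\<bar> \<le> \<rho>"
    using 1(2) norm_triangle_ineq3[of x z] by linarith
  ultimately show "\<bar>norm x - R * norm y\<bar> \<le> \<rho> * (1 + norm y)"
    by (simp add: algebra_simps)
qed

lemma kern_support:
  assumes "kern R x y \<noteq> 0" "\<rho> < R"
  shows "\<bar>norm x - R * norm y\<bar> \<le> \<rho> * (1 + norm y)" "y \<noteq> 0"
proof -
  have "\<exists>z. \<beta> (z /\<^sub>R norm y - R *\<^sub>R e) * \<beta> (x - z) \<noteq> 0"
  proof (rule ccontr)
    assume "\<nexists>z. \<beta> (z /\<^sub>R norm y - R *\<^sub>R e) * \<beta> (x - z) \<noteq> 0"
    then have "(\<lambda>z. \<beta> (z /\<^sub>R norm y - R *\<^sub>R e) * \<beta> (x - z)) = (\<lambda>z. 0)" by (simp add: fun_eq_iff)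
    then have "kern R x y = 0" unfolding kern_def by (simp only: integral_zero)
    then show False using assms by simp
  qed
  then show "\<bar>norm x - R * norm y\<bar> \<le> \<rho> * (1 + norm y)" "y \<noteq> 0"
    using kern_integrand_support[OF _ assms(2)] by blast+
qed

text \<open>By Tonelli, integrating over \<open>x\<close> gives one factor \<open>mass\<close>, and
  rescaling \<open>z\<close> by \<open>norm y\<close> gives the other together with the Jacobian.
  The value does not depend on \<open>R\<close>, so a nonzero limit survives the spreading.\<close>

lemma kern_nn_integral:
  assumes R: "\<rho> < R"
  shows "(\<integral>\<^sup>+x. ennreal (kern R x y) \<partial>lborel) = ennreal (mass\<^sup>2 * norm y ^ CARD('n))"
proof (cases "y = 0")
  case True
  then have "kern R x y = 0" for x using kern_support(2)[OF _ R] by blast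
  then show ?thesis using True by simp
next
  case False
  have m: "(\<integral>\<^sup>+x. ennreal (\<beta> x) \<partial>lborel) = ennreal mass"
    unfolding mass_def by (intro nn_integral_eq_integral bump_integrable) (simp add: bump_nonneg)
  have "(\<integral>\<^sup>+x. ennreal (kern R x y) \<partial>lborel) =
      (\<integral>\<^sup>+x. \<integral>\<^sup>+z. ennreal (\<beta> (z /\<^sub>R norm y - R *\<^sub>R e)) * ennreal (\<beta> (x - z)) \<partial>lborel \<partial>lborel)"
    unfolding kern_def
    by (intro nn_integral_cong, subst nn_integral_eq_integral[symmetric])
       (auto intro: kern_integrand_integrable simp: bump_nonneg ennreal_mult)
  also have "\<dots> = (\<integral>\<^sup>+z. \<integral>\<^sup>+x. ennreal (\<beta> (z /\<^sub>R norm y - R *\<^sub>R e)) * ennreal (\<beta> (x - z)) \<partial>lborel \<partial>lborel)"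
    by (rule lborel_pair.Fubini') measurable
  also have "\<dots> = (\<integral>\<^sup>+z. ennreal (\<beta> (z /\<^sub>R norm y - R *\<^sub>R e)) * ennreal mass \<partial>lborel)"
  proof (intro nn_integral_cong)
    fix z
    have "(\<integral>\<^sup>+x. ennreal (\<beta> (x - z)) \<partial>lborel) = ennreal mass"
      using nn_integral_lborel_affine[of "\<lambda>x. ennreal (\<beta> x)" 1 "-z"] m by simp
    then show "(\<integral>\<^sup>+x. ennreal (\<beta> (z /\<^sub>R norm y - R *\<^sub>R e)) * ennreal (\<beta> (x - z)) \<partial>lborel) =
        ennreal (\<beta> (z /\<^sub>R norm y - R *\<^sub>R e)) * ennreal mass"
      by (simp add: nn_integral_cmult)
  qed
  also have "\<dots> = (\<integral>\<^sup>+z. ennreal (\<beta> (z /\<^sub>R norm y - R *\<^sub>R e)) \<partial>lborel) * ennreal mass"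
    by (rule nn_integral_multc) measurable
  also have "(\<integral>\<^sup>+z. ennreal (\<beta> (z /\<^sub>R norm y - R *\<^sub>R e)) \<partial>lborel) = ennreal (norm y ^ CARD('n)) * ennreal mass"
    using nn_integral_lborel_affine[of "\<lambda>z. ennreal (\<beta> (z /\<^sub>R norm y - R *\<^sub>R e))" "norm y" "(norm y * R) *\<^sub>R e"] False m
    by (simp add: scaleR_add_right mult.assoc[symmetric])
  finally show ?thesis
    using mass_nonneg by (simp add: ennreal_mult[symmetric] power2_eq_square mult_ac)
qed

lemma
  assumes R: "\<rho> < R"
  shows kern_integrable: "integrable lborel (\<lambda>x. kern R x y)"
    and kern_integral: "(LINT x|lborel. kern R x y) = mass\<^sup>2 * norm y ^ CARD('n)"
proof -
  have "has_bochner_integral lborel (\<lambda>x. kern R x y) (mass\<^sup>2 * norm y ^ CARD('n))"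
    using kern_nn_integral[OF R, of y] by (intro has_bochner_integral_nn_integral) (auto simp: kern_nonneg)
  then show "integrable lborel (\<lambda>x. kern R x y)" "(LINT x|lborel. kern R x y) = mass\<^sup>2 * norm y ^ CARD('n)"
    by (auto simp: has_bochner_integral_iff)
qed

end

subsection \<open>Small mean from a bounded quasi-norm\<close>

text \<open>The sets where \<open>norm (W y)\<close> exceeds \<open>k\<close> shrink to the empty
  set, so dominated convergence applies. The cut makes up for \<open>W\<close> being unbounded:
  below height \<open>k\<close>, its integral over a thin shell is controlled by the volume of that
  shell.\<close>

lemma truncated_tail_small:
  fixes W :: "'a::euclidean_space \<Rightarrow> complex"
  assumes W: "integrable lborel W" and "0 < \<epsilon>"
  obtains k :: real where "0 < k"
    "(\<integral>\<^sup>+y. ennreal (norm (W y) * indicator {k<..} (norm (W y))) \<partial>lborel) < ennreal \<epsilon>"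
proof -
  have [measurable]: "W \<in> borel_measurable borel" using W by auto
  have int: "integrable lborel (\<lambda>y. norm (W y) * indicator {k<..} (norm (W y)))" for k
    by (rule Bochner_Integration.integrable_bound[OF W]) (auto simp: indicator_def)
  have "(\<lambda>k. LINT y|lborel. norm (W y) * indicator {real k<..} (norm (W y))) \<longlonglongrightarrow> (LINT y|(lborel::'a measure). 0)"
  proof (rule integral_dominated_convergence[where w = "\<lambda>y. norm (W y)"])
    show "AE y in lborel. (\<lambda>k. norm (W y) * indicator {real k<..} (norm (W y))) \<longlonglongrightarrow> 0"
    proof (rule AE_I2, rule tendsto_eventually)
      fix y
      have "eventually (\<lambda>k. norm (W y) \<le> real k) sequentially"
        using filterlim_real_sequentially by (simp add: filterlim_at_top)
      then show "eventually (\<lambda>k. norm (W y) * indicator {real k<..} (norm (W y)) = 0) sequentially"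
        by eventually_elim simp
    qed
  qed (use W in \<open>auto simp: indicator_def\<close>)
  then have "eventually (\<lambda>k. (LINT y|lborel. norm (W y) * indicator {real k<..} (norm (W y))) < \<epsilon>) sequentially"
    using \<open>0 < \<epsilon>\<close> by (intro order_tendstoD(2)) auto
  moreover have "eventually (\<lambda>k. k > (0::nat)) sequentially" by (rule eventually_gt_at_top)
  ultimately have "eventually (\<lambda>k. k > 0 \<and> (LINT y|lborel. norm (W y) * indicator {real k<..} (norm (W y))) < \<epsilon>) sequentially"
    by eventually_elim simp
  then obtain k :: nat where k: "k > 0" "(LINT y|lborel. norm (W y) * indicator {real k<..} (norm (W y))) < \<epsilon>"
    using eventually_happens'[OF sequentially_bot] by blast
  show ?thesis
  proof
    show "0 < real k" using k by simp
    have "(\<integral>\<^sup>+y. ennreal (norm (W y) * indicator {real k<..} (norm (W y))) \<partial>lborel) =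
        ennreal (LINT y|lborel. norm (W y) * indicator {real k<..} (norm (W y)))"
      by (intro nn_integral_eq_integral int) simp
    then show "(\<integral>\<^sup>+y. ennreal (norm (W y) * indicator {real k<..} (norm (W y))) \<partial>lborel) < ennreal \<epsilon>"
      using k(2) \<open>0 < \<epsilon>\<close> by (simp add: ennreal_lessI)
  qed
qed

text \<open>This is where \<open>p < 1\<close> enters: a function that is uniformly small up to an error small in
  mean has small integral as soon as its \<open>p\<close>-th power has bounded integral.\<close>

lemma le_powr_interpolation:
  fixes q t :: real and g :: ennreal
  assumes p: "0 < p" "p < 1" and q: "0 \<le> q" "0 \<le> t" and le: "ennreal q \<le> ennreal t + g"
  shows "ennreal q \<le> ennreal ((2 * t) powr (1 - p) * q powr p) + 2 * g"
\<comment> \<open>If \<open>q\<close> is at most \<open>2 * t\<close>, part of its power is traded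
  for a power of \<open>2 * t\<close>. Otherwise \<open>t\<close> accounts for less than half of
  \<open>q\<close>, so \<open>g\<close> carries the rest and \<open>q \<le> 2 * g\<close>.\<close>
proof (cases "q \<le> 2 * t")
  case True
  have "q = q powr (1 - p) * q powr p"
    using q p by (cases "q = 0") (simp_all add: powr_add[symmetric])
  also have "\<dots> \<le> (2 * t) powr (1 - p) * q powr p"
    using True q p by (intro mult_right_mono powr_mono2) auto
  finally have "ennreal q \<le> ennreal ((2 * t) powr (1 - p) * q powr p)"
    by (rule ennreal_leI)
  then show ?thesis by (simp add: add_increasing2)
next
  case False
  show ?thesis
  proof (cases g)
    case (real r)
    then have "q \<le> t + r" using le q by (simp add: ennreal_plus[symmetric] del: ennreal_plus)
    then have "q \<le> 2 * r" using False by simp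
    then have "ennreal q \<le> ennreal (2 * r)" by (rule ennreal_leI)
    also have "ennreal (2 * r) = 2 * g" using real by (simp add: ennreal_mult)
    finally show ?thesis by (simp add: add_increasing)
  qed (simp add: ennreal_mult_top)
qed

context bump
begin

text \<open>With \<open>W\<close> equal to \<open>\<Phi>\<close> cut to a shell, this is the
  convolution of \<open>\<beta>\<close> with the image of the translated bump, as long as
  \<open>norm x / R\<close> stays in the matching interval.\<close>

definition smear :: "(real^'n \<Rightarrow> complex) \<Rightarrow> real \<Rightarrow> real^'n \<Rightarrow> complex" where
  "smear W R x = (LINT y|lborel. W y * of_real (kern R x y))"

lemma smear_integrand_integrable:
  fixes W :: "real^'n \<Rightarrow> complex"
  assumes W: "integrable lborel W"
  shows "integrable lborel (\<lambda>y. W y * of_real (kern R x y))"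
proof (rule Bochner_Integration.integrable_bound)
  show "integrable lborel (\<lambda>y. mass *\<^sub>R W y)" using W by (rule integrable_scaleR_right)
  show "AE y in lborel. norm (W y * of_real (kern R x y)) \<le> norm (mass *\<^sub>R W y)"
    using kern_nonneg kern_le mass_nonneg
    by (auto simp: norm_mult mult.commute[of mass] intro!: mult_left_mono)
  have [measurable]: "W \<in> borel_measurable borel" using W by auto
  show "(\<lambda>y. W y * of_real (kern R x y)) \<in> borel_measurable lborel" by measurable
qed

lemma smear_measurable:
  assumes W: "integrable lborel W"
  shows "smear W R \<in> borel_measurable borel"
proof -
  have [measurable]: "W \<in> borel_measurable borel" using W by auto
  show ?thesis unfolding smear_def by measurable
qed

text \<open>Where \<open>norm (W y) \<le> k\<close>, the integrand is at most
  \<open>k * mass\<close> and lives on a shell of thickness of order \<open>1 / R\<close>; this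
  gives the first summand. The second collects the large values of \<open>W\<close>.\<close>

lemma smear_pointwise_le:
  fixes B k :: real
  assumes W: "integrable lborel W" and WB: "\<And>y. W y \<noteq> 0 \<Longrightarrow> norm y \<le> B"
    and "0 < B" "0 < k" and R: "\<rho> < R"
  shows "ennreal (norm (smear W R x)) \<le>
      ennreal (k * mass * (unit_ball_vol CARD('n) * (CARD('n) * B ^ (CARD('n) - 1) * (2 * (\<rho> * (1 + B) / R))))) +
      (\<integral>\<^sup>+y. ennreal (norm (W y) * indicator {k<..} (norm (W y))) * ennreal (kern R x y) \<partial>lborel)"
proof -
  have [measurable]: "W \<in> borel_measurable borel" using W by auto
  have R0: "0 < R" using R radius_pos by simp
  define S where "S = {y::real^'n. \<bar>norm y - norm x / R\<bar> \<le> \<rho> * (1 + B) / R \<and> norm y \<le> B}"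
  have [measurable]: "S \<in> sets borel" unfolding S_def by measurable
  have pt: "ennreal (norm (W y * of_real (kern R x y))) \<le> ennreal (k * mass) * indicator S y +
      ennreal (norm (W y) * indicator {k<..} (norm (W y))) * ennreal (kern R x y)" for y
  proof (cases "W y = 0 \<or> kern R x y = 0 \<or> k < norm (W y)")
    case True
    then show ?thesis using kern_nonneg by (auto simp: norm_mult ennreal_mult add_increasing)
  next
    case False
    then have yB: "norm y \<le> B" using WB by blast
    have "\<bar>norm x - R * norm y\<bar> \<le> \<rho> * (1 + norm y)" using False kern_support R by blast
    also have "\<dots> \<le> \<rho> * (1 + B)" using yB radius_pos by simp
    finally have "\<bar>norm x - R * norm y\<bar> / R \<le> \<rho> * (1 + B) / R" using R0 by (simp add: divide_right_mono)
    moreover have "\<bar>norm x - R * norm y\<bar> / R = \<bar>norm y - norm x / R\<bar>"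
    proof -
      have "norm y - norm x / R = - ((norm x - R * norm y) / R)" using R0 by (simp add: field_simps)
      then show ?thesis using R0 by (simp add: abs_divide)
    qed
    ultimately have "y \<in> S" using yB by (simp add: S_def)
    moreover have "norm (W y * of_real (kern R x y)) \<le> k * mass"
      using False kern_nonneg kern_le mass_nonneg \<open>0 < k\<close> by (auto simp: norm_mult intro!: mult_mono)
    ultimately show ?thesis by (simp add: ennreal_leI add_increasing2)
  qed
  have "ennreal (norm (smear W R x)) \<le> (\<integral>\<^sup>+y. ennreal (norm (W y * of_real (kern R x y))) \<partial>lborel)"
    unfolding smear_def by (rule integral_norm_bound_ennreal[OF smear_integrand_integrable[OF W]])
  also have "\<dots> \<le> (\<integral>\<^sup>+y. ennreal (k * mass) * indicator S y +
      ennreal (norm (W y) * indicator {k<..} (norm (W y))) * ennreal (kern R x y) \<partial>lborel)"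
    by (intro nn_integral_mono pt)
  also have "\<dots> = ennreal (k * mass) * emeasure lborel S +
      (\<integral>\<^sup>+y. ennreal (norm (W y) * indicator {k<..} (norm (W y))) * ennreal (kern R x y) \<partial>lborel)"
    by (simp add: nn_integral_add nn_integral_cmult)
  also have "ennreal (k * mass) * emeasure lborel S \<le>
      ennreal (k * mass) * ennreal (unit_ball_vol CARD('n) * (CARD('n) * B ^ (CARD('n) - 1) * (2 * (\<rho> * (1 + B) / R))))"
    unfolding S_def
    using emeasure_annulus_le[where ?'a = "real^'n", of "\<rho> * (1 + B) / R" B "norm x / R"] radius_pos R0 \<open>0 < B\<close>
    by (intro mult_left_mono) auto
  also have "\<dots> = ennreal (k * mass * (unit_ball_vol CARD('n) * (CARD('n) * B ^ (CARD('n) - 1) * (2 * (\<rho> * (1 + B) / R)))))"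
    using mass_nonneg \<open>0 < k\<close> by (intro ennreal_mult[symmetric]) (auto intro!: mult_nonneg_nonneg divide_nonneg_nonneg simp: radius_pos R0 less_imp_le \<open>0 < B\<close> add_nonneg_nonneg)
  finally show ?thesis by (simp add: add_right_mono)
qed

text \<open>Exchanging the integrals reduces the \<open>x\<close>-integral to
  \<open>kern_nn_integral\<close>. The resulting bound is uniform in \<open>R\<close>, so
  \<open>k\<close> can be fixed before \<open>R\<close> tends to infinity.\<close>

lemma smear_tail_integral:
  assumes W: "integrable lborel W" and WB: "\<And>y. W y \<noteq> 0 \<Longrightarrow> norm y \<le> B"
    and B: "0 < B" and R: "\<rho> < R"
  shows "(\<integral>\<^sup>+x. \<integral>\<^sup>+y. ennreal (norm (W y) * indicator {k<..} (norm (W y))) * ennreal (kern R x y) \<partial>lborel \<partial>lborel)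
      \<le> ennreal (mass\<^sup>2 * B ^ CARD('n)) * (\<integral>\<^sup>+y. ennreal (norm (W y) * indicator {k<..} (norm (W y))) \<partial>lborel)"
proof -
  have [measurable]: "W \<in> borel_measurable borel" using W by auto
  have "(\<integral>\<^sup>+x. \<integral>\<^sup>+y. ennreal (norm (W y) * indicator {k<..} (norm (W y))) * ennreal (kern R x y) \<partial>lborel \<partial>lborel) =
      (\<integral>\<^sup>+y. \<integral>\<^sup>+x. ennreal (norm (W y) * indicator {k<..} (norm (W y))) * ennreal (kern R x y) \<partial>lborel \<partial>lborel)"
    by (rule lborel_pair.Fubini'[symmetric]) measurable
  also have "\<dots> = (\<integral>\<^sup>+y. ennreal (norm (W y) * indicator {k<..} (norm (W y))) * ennreal (mass\<^sup>2 * norm y ^ CARD('n)) \<partial>lborel)"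
    by (simp add: nn_integral_cmult kern_nn_integral[OF R])
  also have "\<dots> \<le> (\<integral>\<^sup>+y. ennreal (mass\<^sup>2 * B ^ CARD('n)) * ennreal (norm (W y) * indicator {k<..} (norm (W y))) \<partial>lborel)"
  proof (intro nn_integral_mono)
    fix y
    show "ennreal (norm (W y) * indicator {k<..} (norm (W y))) * ennreal (mass\<^sup>2 * norm y ^ CARD('n))
        \<le> ennreal (mass\<^sup>2 * B ^ CARD('n)) * ennreal (norm (W y) * indicator {k<..} (norm (W y)))"
    proof (cases "W y = 0")
      case False
      then have "mass\<^sup>2 * norm y ^ CARD('n) \<le> mass\<^sup>2 * B ^ CARD('n)"
        by (intro mult_left_mono power_mono WB) auto
      then show ?thesis
        by (subst mult.commute) (intro mult_right_mono ennreal_leI, auto)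
    qed simp
  qed
  also have "\<dots> = ennreal (mass\<^sup>2 * B ^ CARD('n)) * (\<integral>\<^sup>+y. ennreal (norm (W y) * indicator {k<..} (norm (W y))) \<partial>lborel)"
    by (rule nn_integral_cmult) measurable
  finally show ?thesis .
qed

lemma smear_region_integral_small:
  assumes W: "integrable lborel W" and WB: "\<And>y. W y \<noteq> 0 \<Longrightarrow> norm y \<le> B" and B: "0 < B"
    and p: "0 < p" "p < 1" and M: "0 \<le> M" and [measurable]: "\<And>R. A R \<in> sets borel"
    and bound: "\<And>R. R0 \<le> R \<Longrightarrow>
      (\<integral>\<^sup>+x. indicator (A R) x * ennreal (norm (smear W R x) powr p) \<partial>lborel) \<le> ennreal M"
    and \<epsilon>: "0 < \<epsilon>"
  shows "eventually (\<lambda>R. (\<integral>\<^sup>+x. indicator (A R) x * ennreal (norm (smear W R x)) \<partial>lborel) \<le> ennreal \<epsilon>) at_top"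
proof -
  have Wm[measurable]: "W \<in> borel_measurable borel" using W by auto
  have [measurable]: "smear W R \<in> borel_measurable borel" for R by (rule smear_measurable[OF W])
  \<comment> \<open>The added 1 only ensures positivity, so that \<open>\<epsilon> / (4 * c)\<close>
    is a positive tolerance. The tail then contributes at most \<open>\<epsilon> / 4\<close>,
    doubled to \<open>\<epsilon> / 2\<close> by the interpolation.\<close>
  define c where "c = mass\<^sup>2 * B ^ CARD('n) + 1"
  have c: "c > 0" "mass\<^sup>2 * B ^ CARD('n) \<le> c" using B by (auto simp: c_def intro!: add_nonneg_pos)
  obtain k where k: "0 < k"
    "(\<integral>\<^sup>+y. ennreal (norm (W y) * indicator {k<..} (norm (W y))) \<partial>lborel) < ennreal (\<epsilon> / (4 * c))"
    using truncated_tail_small[OF W, of "\<epsilon> / (4 * c)"] \<epsilon> c by auto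
  \<comment> \<open>This is the constant of the pointwise bound with the factor \<open>1 / R\<close>
    taken out.\<close>
  define V where "V = k * mass * (unit_ball_vol CARD('n) * (CARD('n) * B ^ (CARD('n) - 1) * (2 * (\<rho> * (1 + B)))))"
  have V: "0 \<le> V" unfolding V_def using k mass_nonneg B radius_pos by (intro mult_nonneg_nonneg) auto
  define T where "T R x = (\<integral>\<^sup>+y. ennreal (norm (W y) * indicator {k<..} (norm (W y))) * ennreal (kern R x y) \<partial>lborel)" for R x
  have Tm[measurable]: "T R \<in> borel_measurable borel" for R unfolding T_def by measurable
  have main: "(\<integral>\<^sup>+x. indicator (A R) x * ennreal (norm (smear W R x)) \<partial>lborel) \<le>
      ennreal ((2 * (V / R)) powr (1 - p) * M + \<epsilon> / 2)" if R: "\<rho> < R" "R0 \<le> R" for R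
  proof -
    have Rp: "0 < R" using R radius_pos by simp
    have "ennreal (norm (smear W R x)) \<le> ennreal ((2 * (V / R)) powr (1 - p) * norm (smear W R x) powr p) + 2 * T R x" for x
    proof (rule le_powr_interpolation[OF p])
      show "ennreal (norm (smear W R x)) \<le> ennreal (V / R) + T R x"
        using smear_pointwise_le[OF W WB B k(1) R(1), of x] by (simp add: T_def V_def)
    qed (use V Rp in auto)
    then have "indicator (A R) x * ennreal (norm (smear W R x)) \<le>
        ennreal ((2 * (V / R)) powr (1 - p)) * (indicator (A R) x * ennreal (norm (smear W R x) powr p)) + 2 * T R x" for x
      by (auto simp: indicator_def ennreal_mult)
    then have "(\<integral>\<^sup>+x. indicator (A R) x * ennreal (norm (smear W R x)) \<partial>lborel) \<le>
        (\<integral>\<^sup>+x. ennreal ((2 * (V / R)) powr (1 - p)) * (indicator (A R) x * ennreal (norm (smear W R x) powr p)) + 2 * T R x \<partial>lborel)"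
      by (intro nn_integral_mono)
    also have "\<dots> = ennreal ((2 * (V / R)) powr (1 - p)) * (\<integral>\<^sup>+x. indicator (A R) x * ennreal (norm (smear W R x) powr p) \<partial>lborel)
        + 2 * (\<integral>\<^sup>+x. T R x \<partial>lborel)"
      by (subst nn_integral_add) (auto simp: nn_integral_cmult)
    also have "\<dots> \<le> ennreal ((2 * (V / R)) powr (1 - p)) * ennreal M + 2 * ennreal (\<epsilon> / 4)"
    proof (intro add_mono mult_left_mono bound R)
      have "(\<integral>\<^sup>+x. T R x \<partial>lborel) \<le> ennreal (mass\<^sup>2 * B ^ CARD('n)) * (\<integral>\<^sup>+y. ennreal (norm (W y) * indicator {k<..} (norm (W y))) \<partial>lborel)"
        unfolding T_def by (rule smear_tail_integral[OF W WB B R(1)])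
      also have "\<dots> \<le> ennreal c * ennreal (\<epsilon> / (4 * c))"
        using k(2) c by (intro mult_mono ennreal_leI) auto
      also have "\<dots> = ennreal (\<epsilon> / 4)"
        using c \<epsilon> by (subst ennreal_mult[symmetric]) auto
      finally show "(\<integral>\<^sup>+x. T R x \<partial>lborel) \<le> ennreal (\<epsilon> / 4)" .
    qed auto
    also have "2 * ennreal (\<epsilon> / 4) = ennreal (\<epsilon> / 2)"
      using ennreal_mult[of 2 "\<epsilon> / 4"] \<epsilon> by simp
    also have "ennreal ((2 * (V / R)) powr (1 - p)) * ennreal M = ennreal ((2 * (V / R)) powr (1 - p) * M)"
      using M by (simp add: ennreal_mult)
    also have "\<dots> + ennreal (\<epsilon> / 2) = ennreal ((2 * (V / R)) powr (1 - p) * M + \<epsilon> / 2)"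
      using M \<epsilon> by (subst ennreal_plus) auto
    finally show ?thesis .
  qed
  have "((\<lambda>R. 2 * (V / R)) \<longlongrightarrow> 2 * 0) at_top"
    by (intro tendsto_mult tendsto_const tendsto_divide_0[OF tendsto_const] filterlim_at_top_imp_at_infinity filterlim_ident)
  then have "((\<lambda>R. (2 * (V / R)) powr (1 - p) * M) \<longlongrightarrow> 0 powr (1 - p) * M) at_top"
    using p V by (intro tendsto_mult tendsto_const tendsto_powr2)
      (auto intro!: eventually_mono[OF eventually_gt_at_top[of 0]])
  then have "eventually (\<lambda>R. (2 * (V / R)) powr (1 - p) * M < \<epsilon> / 2) at_top"
    using \<epsilon> by (intro order_tendstoD(2)) auto
  then show ?thesis
    using eventually_gt_at_top[of \<rho>] eventually_ge_at_top[of R0]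
  proof eventually_elim
    case (elim R)
    have "(\<integral>\<^sup>+x. indicator (A R) x * ennreal (norm (smear W R x)) \<partial>lborel) \<le>
      ennreal ((2 * (V / R)) powr (1 - p) * M + \<epsilon> / 2)" using elim by (intro main)
    also have "\<dots> \<le> ennreal \<epsilon>" using elim by (intro ennreal_leI) simp
    finally show ?case .
  qed
qed

text \<open>For a Lipschitz weight \<open>\<eta>\<close>, the kernel \<open>kern R x y\<close> concentrates on
  \<open>norm x / R \<approx> norm y\<close>, which identifies the limit of the weighted integrals.\<close>

lemma smear_weighted_integral:
  assumes W: "integrable lborel W" and WB: "\<And>y. W y \<noteq> 0 \<Longrightarrow> norm y \<le> B" and B: "0 < B"
    and lip: "\<And>r s. \<bar>\<eta> r - \<eta> s\<bar> \<le> L * \<bar>r - s\<bar>" and L: "0 \<le> L"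
    and \<eta>1: "\<And>r. \<bar>\<eta> r\<bar> \<le> 1" and \<eta>0: "\<And>r. b < r \<Longrightarrow> \<eta> r = 0"
    and [measurable]: "\<eta> \<in> borel_measurable borel" and R: "\<rho> < R"
  shows "norm ((LINT x|lborel. smear W R x * of_real (\<eta> (norm x / R))) -
      (LINT y|lborel. W y * of_real (mass\<^sup>2 * norm y ^ CARD('n) * \<eta> (norm y))))
    \<le> L * (\<rho> * (1 + B) / R) * (mass\<^sup>2 * B ^ CARD('n)) * (LINT y|lborel. norm (W y))"
proof -
  have Wm[measurable]: "W \<in> borel_measurable borel" using W by auto
  have Rp: "0 < R" using R radius_pos by simp
  define F where "F x y = W y * of_real (kern R x y) * of_real (\<eta> (norm x / R))" for x y
  \<comment> \<open>The weight \<open>\<eta> (norm x / R)\<close> confines \<open>x\<close> to the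
    ball of radius \<open>b * R\<close>; together with the integrability of \<open>W\<close> this
    justifies Fubini.\<close>
  have pair: "integrable (lborel \<Otimes>\<^sub>M lborel) (\<lambda>(x, y). F x y)"
  proof (rule Bochner_Integration.integrable_bound)
    show "integrable (lborel \<Otimes>\<^sub>M lborel) (\<lambda>(x::real^'n, y). (mass * indicator (cball 0 (b * R)) x) * norm (W y))"
    proof (rule integrable_pair_product)
      show "integrable lborel (\<lambda>x. mass * indicator (cball (0::real^'n) (b * R)) x)"
        using emeasure_bounded_finite[of "cball (0::real^'n) (b * R)"]
        by (intro integrable_mult_right integrable_real_indicator) auto
      show "integrable lborel (\<lambda>y. norm (W y))" using W by simp
    qed
    show "(\<lambda>(x, y). F x y) \<in> borel_measurable (lborel \<Otimes>\<^sub>M lborel)"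
      unfolding F_def by measurable
    have "norm (F x y) \<le> (mass * indicator (cball 0 (b * R)) x) * norm (W y)" for x y
    proof (cases "norm x \<le> b * R")
      case True
      have "norm (F x y) = norm (W y) * (kern R x y * \<bar>\<eta> (norm x / R)\<bar>)"
        using kern_nonneg by (simp add: F_def norm_mult)
      also have "\<dots> \<le> norm (W y) * (mass * 1)"
        using kern_nonneg kern_le mass_nonneg \<eta>1 by (intro mult_left_mono mult_mono) auto
      finally show ?thesis using True by (simp add: mult.commute)
    next
      case False
      then have "b < norm x / R" using Rp by (simp add: field_simps)
      then show ?thesis using mass_nonneg by (simp add: F_def \<eta>0)
    qed
    then show "AE z in lborel \<Otimes>\<^sub>M lborel. norm (case z of (x, y) \<Rightarrow> F x y)
        \<le> norm (case z of (x, y) \<Rightarrow> (mass * indicator (cball 0 (b * R)) x) * norm (W y))"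
      using mass_nonneg by (auto simp: abs_mult intro!: AE_I2)
  qed
  define \<Lambda> where "\<Lambda> y = (LINT x|lborel. kern R x y * \<eta> (norm x / R))" for y
  have Fy: "(LINT x|lborel. F x y) = W y * of_real (\<Lambda> y)" for y
  proof -
    have "(LINT x|lborel. F x y) = (LINT x|lborel. W y * of_real (kern R x y * \<eta> (norm x / R)))"
      by (simp add: F_def mult.assoc)
    then show ?thesis
      by (simp only: \<Lambda>_def integral_mult_right_zero integral_complex_of_real)
  qed
  have "(LINT x|lborel. smear W R x * of_real (\<eta> (norm x / R))) = (LINT x|lborel. LINT y|lborel. F x y)"
    unfolding smear_def F_def by simp
  also have "\<dots> = (LINT y|lborel. LINT x|lborel. F x y)"
    by (rule lborel_pair.Fubini_integral[symmetric]) (rule pair)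
  finally have J: "(LINT x|lborel. smear W R x * of_real (\<eta> (norm x / R))) = (LINT y|lborel. W y * of_real (\<Lambda> y))"
    by (simp add: Fy)
  have i1: "integrable lborel (\<lambda>y. W y * of_real (\<Lambda> y))"
    using lborel_pair.integrable_snd[OF pair] by (simp add: Fy)
  have i2: "integrable lborel (\<lambda>y. W y * of_real (mass\<^sup>2 * norm y ^ CARD('n) * \<eta> (norm y)))"
  proof (rule Bochner_Integration.integrable_bound)
    show "integrable lborel (\<lambda>y. (mass\<^sup>2 * B ^ CARD('n)) *\<^sub>R W y)" using W by (rule integrable_scaleR_right)
    have "norm (W y * of_real (mass\<^sup>2 * norm y ^ CARD('n) * \<eta> (norm y))) \<le> norm ((mass\<^sup>2 * B ^ CARD('n)) *\<^sub>R W y)" for y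
    proof (cases "W y = 0")
      case False
      have "norm (W y * of_real (mass\<^sup>2 * norm y ^ CARD('n) * \<eta> (norm y))) =
          norm (W y) * (mass\<^sup>2 * norm y ^ CARD('n) * \<bar>\<eta> (norm y)\<bar>)"
        by (simp only: norm_mult norm_of_real abs_mult) simp
      also have "\<dots> \<le> norm (W y) * (mass\<^sup>2 * B ^ CARD('n) * 1)"
        using WB[OF False] \<eta>1 B by (intro mult_left_mono mult_mono power_mono) auto
      also have "\<dots> = norm ((mass\<^sup>2 * B ^ CARD('n)) *\<^sub>R W y)" using B by (simp add: mult.commute abs_mult)
      finally show ?thesis .
    qed simp
    then show "AE y in lborel. norm (W y * of_real (mass\<^sup>2 * norm y ^ CARD('n) * \<eta> (norm y))) \<le> norm ((mass\<^sup>2 * B ^ CARD('n)) *\<^sub>R W y)"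
      by simp
  qed measurable
  \<comment> \<open>The Lipschitz constant times the largest distance between
    \<open>norm x / R\<close> and \<open>norm y\<close> on the support of the kernel: this bounds
    the error of replacing one argument of \<open>\<eta>\<close> by the other.\<close>
  define C where "C = L * (\<rho> * (1 + B) / R)"
  have C0: "0 \<le> C" using L B radius_pos Rp by (simp add: C_def)
  have \<Lambda>: "\<bar>\<Lambda> y - mass\<^sup>2 * norm y ^ CARD('n) * \<eta> (norm y)\<bar> \<le> C * (mass\<^sup>2 * B ^ CARD('n))" if y: "norm y \<le> B" for y
  proof -
    have pt: "\<bar>kern R x y * \<eta> (norm x / R) - kern R x y * \<eta> (norm y)\<bar> \<le> C * kern R x y" for x
    proof (cases "kern R x y = 0")
      case False
      have "\<bar>norm x - R * norm y\<bar> \<le> \<rho> * (1 + norm y)" using False kern_support R by blast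
      also have "\<dots> \<le> \<rho> * (1 + B)" using y radius_pos by simp
      finally have "\<bar>norm x - R * norm y\<bar> / R \<le> \<rho> * (1 + B) / R" using Rp by (simp add: divide_right_mono)
      moreover have "\<bar>norm x - R * norm y\<bar> / R = \<bar>norm x / R - norm y\<bar>"
      proof -
        have "norm x / R - norm y = (norm x - R * norm y) / R" using Rp by (simp add: field_simps)
        then show ?thesis using Rp by (simp add: abs_divide)
      qed
      ultimately have "L * \<bar>norm x / R - norm y\<bar> \<le> C" unfolding C_def using L by (intro mult_left_mono) auto
      then have "\<bar>\<eta> (norm x / R) - \<eta> (norm y)\<bar> \<le> C" using lip[of "norm x / R" "norm y"] by linarith
      then have "kern R x y * \<bar>\<eta> (norm x / R) - \<eta> (norm y)\<bar> \<le> kern R x y * C"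
        using kern_nonneg by (intro mult_left_mono) auto
      moreover have "kern R x y * \<eta> (norm x / R) - kern R x y * \<eta> (norm y) = kern R x y * (\<eta> (norm x / R) - \<eta> (norm y))"
        by (rule right_diff_distrib[symmetric])
      ultimately show ?thesis using kern_nonneg[of R x y]
        by (simp only: abs_mult abs_of_nonneg mult.commute[of C])
    qed simp
    have ik: "integrable lborel (\<lambda>x. kern R x y * \<eta> (norm x / R))"
    proof (rule Bochner_Integration.integrable_bound[OF kern_integrable[OF R, of y]])
      show "AE x in lborel. norm (kern R x y * \<eta> (norm x / R)) \<le> norm (kern R x y)"
        using \<eta>1 by (auto simp: abs_mult intro!: mult_left_le)
    qed measurable
    have ik2: "integrable lborel (\<lambda>x. kern R x y * \<eta> (norm y))"
      using kern_integrable[OF R, of y] by simp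
    have "\<Lambda> y - mass\<^sup>2 * norm y ^ CARD('n) * \<eta> (norm y) =
        (LINT x|lborel. kern R x y * \<eta> (norm x / R) - kern R x y * \<eta> (norm y))"
      using Bochner_Integration.integral_diff[OF ik ik2] kern_integral[OF R, of y] by (simp add: \<Lambda>_def)
    also have "\<bar>\<dots>\<bar> \<le> (LINT x|lborel. \<bar>kern R x y * \<eta> (norm x / R) - kern R x y * \<eta> (norm y)\<bar>)"
      by (rule integral_abs_bound)
    also have "\<dots> \<le> (LINT x|lborel. C * kern R x y)"
      using ik ik2 kern_integrable[OF R, of y] by (intro integral_mono pt integrable_abs Bochner_Integration.integrable_diff) auto
    also have "\<dots> = C * (mass\<^sup>2 * norm y ^ CARD('n))" using kern_integral[OF R, of y] by simp
    also have "\<dots> \<le> C * (mass\<^sup>2 * B ^ CARD('n))"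
      using C0 y by (intro mult_left_mono power_mono) auto
    finally show ?thesis .
  qed
  have "norm ((LINT y|lborel. W y * of_real (\<Lambda> y)) - (LINT y|lborel. W y * of_real (mass\<^sup>2 * norm y ^ CARD('n) * \<eta> (norm y)))) =
      norm (LINT y|lborel. W y * of_real (\<Lambda> y) - W y * of_real (mass\<^sup>2 * norm y ^ CARD('n) * \<eta> (norm y)))"
    by (simp only: Bochner_Integration.integral_diff[OF i1 i2])
  also have "\<dots> \<le> (LINT y|lborel. norm (W y * of_real (\<Lambda> y) - W y * of_real (mass\<^sup>2 * norm y ^ CARD('n) * \<eta> (norm y))))"
    by (rule integral_norm_bound)
  also have "\<dots> \<le> (LINT y|lborel. (C * (mass\<^sup>2 * B ^ CARD('n))) * norm (W y))"
  proof (intro integral_mono integrable_norm Bochner_Integration.integrable_diff i1 i2)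
    show "integrable lborel (\<lambda>y. (C * (mass\<^sup>2 * B ^ CARD('n))) * norm (W y))" using W by simp
    fix y
    show "norm (W y * of_real (\<Lambda> y) - W y * of_real (mass\<^sup>2 * norm y ^ CARD('n) * \<eta> (norm y)))
        \<le> (C * (mass\<^sup>2 * B ^ CARD('n))) * norm (W y)"
    proof (cases "W y = 0")
      case False
      have "norm (W y * of_real (\<Lambda> y) - W y * of_real (mass\<^sup>2 * norm y ^ CARD('n) * \<eta> (norm y))) =
          norm (W y) * \<bar>\<Lambda> y - mass\<^sup>2 * norm y ^ CARD('n) * \<eta> (norm y)\<bar>"
        by (simp only: right_diff_distrib[symmetric] of_real_diff[symmetric] norm_mult norm_of_real)
      also have "\<dots> \<le> norm (W y) * (C * (mass\<^sup>2 * B ^ CARD('n)))"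
        using \<Lambda>[OF WB[OF False]] by (intro mult_left_mono) auto
      finally show ?thesis by (simp add: mult.commute)
    qed simp
  qed
  also have "\<dots> = C * (mass\<^sup>2 * B ^ CARD('n)) * (LINT y|lborel. norm (W y))" by simp
  finally show ?thesis unfolding J C_def .
qed

text \<open>The weighted integrals \<open>J R\<close> have two limits: 0 by the bound on the
  \<open>p\<close>-th powers, and \<open>m\<close> by concentration of the kernel. Hence
  \<open>m = 0\<close>, and the positive factor from \<open>mass\<close> is divided out.\<close>

lemma weighted_radial_integral_zero:
  assumes W: "integrable lborel W" and WB: "\<And>y. W y \<noteq> 0 \<Longrightarrow> norm y \<le> B" and B: "0 < B"
    and lip: "\<And>r s. \<bar>\<eta> r - \<eta> s\<bar> \<le> L * \<bar>r - s\<bar>" and L: "0 \<le> L"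
    and \<eta>1: "\<And>r. \<bar>\<eta> r\<bar> \<le> 1" and \<eta>0: "\<And>r. r \<notin> {a..b} \<Longrightarrow> \<eta> r = 0"
    and [measurable]: "\<eta> \<in> borel_measurable borel"
    and p: "0 < p" "p < 1" and M: "0 \<le> M" and mass: "0 < mass"
    and bound: "\<And>R. R0 \<le> R \<Longrightarrow>
      (\<integral>\<^sup>+x. indicator {x. norm x / R \<in> {a..b}} x * ennreal (norm (smear W R x) powr p) \<partial>lborel) \<le> ennreal M"
  shows "(LINT y|lborel. W y * of_real (norm y ^ CARD('n) * \<eta> (norm y))) = 0"
proof -
  define m where "m = (LINT y|lborel. W y * of_real (mass\<^sup>2 * norm y ^ CARD('n) * \<eta> (norm y)))"
  define J where "J R = (LINT x|lborel. smear W R x * of_real (\<eta> (norm x / R)))" for R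
  have J1: "eventually (\<lambda>R. norm (J R) \<le> \<epsilon>) at_top" if \<epsilon>: "0 < \<epsilon>" for \<epsilon>
  proof -
    have "eventually (\<lambda>R. (\<integral>\<^sup>+x. indicator {x. norm x / R \<in> {a..b}} x * ennreal (norm (smear W R x)) \<partial>lborel) \<le> ennreal \<epsilon>) at_top"
      by (rule smear_region_integral_small[OF W WB B p M _ bound \<epsilon>]) auto
    then show ?thesis
    proof eventually_elim
      case (elim R)
      show ?case
      proof (cases "integrable lborel (\<lambda>x. smear W R x * of_real (\<eta> (norm x / R)))")
        case True
        have "ennreal (norm (J R)) \<le> (\<integral>\<^sup>+x. ennreal (norm (smear W R x * of_real (\<eta> (norm x / R)))) \<partial>lborel)"
          unfolding J_def by (rule integral_norm_bound_ennreal[OF True])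
        also have "\<dots> \<le> (\<integral>\<^sup>+x. indicator {x. norm x / R \<in> {a..b}} x * ennreal (norm (smear W R x)) \<partial>lborel)"
          using \<eta>0 \<eta>1 by (intro nn_integral_mono) (auto simp: indicator_def norm_mult mult_left_le intro!: ennreal_leI)
        also note elim
        finally show ?thesis using \<epsilon> by simp
      next
        \<comment> \<open>A Bochner integral that does not exist has the value 0, so the estimate is
          trivial here.\<close>
        case False
        then show ?thesis using \<epsilon> by (simp add: J_def not_integrable_integral_eq)
      qed
    qed
  qed
  have J2: "((\<lambda>R. L * (\<rho> * (1 + B) / R) * (mass\<^sup>2 * B ^ CARD('n)) * (LINT y|lborel. norm (W y))) \<longlongrightarrow>
      L * 0 * (mass\<^sup>2 * B ^ CARD('n)) * (LINT y|lborel. norm (W y))) at_top"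
    by (intro tendsto_mult tendsto_const tendsto_divide_0[OF tendsto_const] filterlim_at_top_imp_at_infinity filterlim_ident)
  have "norm m \<le> \<epsilon>" if \<epsilon>: "0 < \<epsilon>" for \<epsilon>
  proof -
    have "eventually (\<lambda>R. L * (\<rho> * (1 + B) / R) * (mass\<^sup>2 * B ^ CARD('n)) * (LINT y|lborel. norm (W y)) < \<epsilon> / 2) at_top"
      using J2 \<epsilon> by (intro order_tendstoD(2)[OF J2]) auto
    then have "eventually (\<lambda>R::real. norm m \<le> \<epsilon>) at_top"
      using J1[OF half_gt_zero[OF \<epsilon>]] eventually_gt_at_top[of \<rho>]
    proof eventually_elim
      case (elim R)
      have "norm (J R - m) \<le> L * (\<rho> * (1 + B) / R) * (mass\<^sup>2 * B ^ CARD('n)) * (LINT y|lborel. norm (W y))"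
        unfolding J_def m_def
        using smear_weighted_integral[OF W WB B lip L \<eta>1 _ _ elim(3), of b] \<eta>0 by auto
      then show ?case using elim norm_triangle_ineq2[of m "J R"] norm_minus_commute[of m "J R"] by linarith
    qed
    then show ?thesis by (simp add: eventually_const)
  qed
  then have "m = 0" using field_le_epsilon[of "norm m" 0] by auto
  moreover have "m = of_real (mass\<^sup>2) * (LINT y|lborel. W y * of_real (norm y ^ CARD('n) * \<eta> (norm y)))"
    unfolding m_def by (subst integral_mult_right_zero[symmetric]) (simp add: mult_ac)
  ultimately show ?thesis using mass by simp
qed

end

subsection \<open>Hausdorff operators\<close>

lemma test_function_locally_integrable:
  fixes \<phi> :: "real^'n \<Rightarrow> complex"
  assumes "\<phi> \<in> test_functions"
  shows "\<phi> locally_integrable_on UNIV"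
  unfolding locally_integrable_on_def
proof (intro conjI allI impI)
  have sm: "smooth \<phi>" using assms by (simp add: test_functions_def)
  then have [measurable]: "\<phi> \<in> borel_measurable borel" by (rule smooth_measurable)
  show "\<phi> \<in> borel_measurable (lebesgue_on UNIV)"
    by (simp add: lebesgue_on_UNIV_eq measurable_completion)
  fix K :: "(real^'n) set" assume "compact K \<and> K \<subseteq> UNIV"
  then have K: "compact K" by simp
  then have [measurable]: "K \<in> sets borel" by (simp add: borel_compact)
  have "(\<lambda>x. indicator K x *\<^sub>R \<phi> x) \<in> borel_measurable lborel" by measurable
  then show "\<phi> absolutely_integrable_on K"
    using borel_integrable_compact[OF K smooth_continuous[OF sm]]
    by (simp add: set_integrable_def integrable_completion)
qed

text \<open>In dimension above one, the points \<open>x /\<^sub>R norm y\<close> for fixed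
  \<open>x\<close> fill at most a ray, which is itself null, so no conclusion is available for each
  individual \<open>x\<close>. For fixed \<open>y \<noteq> 0\<close>, dilation preserves null sets;
  a Borel null superset makes the exchange of the two quantifiers possible.\<close>

lemma AE_dilation:
  fixes P :: "'a::euclidean_space \<Rightarrow> bool"
  assumes "AE x in lborel. P x"
  shows "AE x in lborel. AE y in lborel. P (x /\<^sub>R norm (y::'a))"
proof -
  obtain N where N: "{x. \<not> P x} \<subseteq> N" "N \<in> null_sets lborel"
    using assms by (auto simp: eventually_ae_filter)
  then have [measurable]: "N \<in> sets borel" by auto
  have null: "AE x in lborel. x /\<^sub>R norm y \<notin> N" if "y \<noteq> 0" for y :: 'a
  proof -
    have "(\<integral>\<^sup>+x. indicator N x \<partial>lborel) = 0" using N(2) by auto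
    then have "(\<integral>\<^sup>+x. indicator N (x /\<^sub>R norm y) \<partial>lborel) = 0"
      using nn_integral_lborel_affine[of "indicator N" "inverse (norm y)" 0] that by simp
    moreover have "(\<lambda>x. indicator N (x /\<^sub>R norm y) :: ennreal) \<in> borel_measurable lborel" by measurable
    ultimately have "AE x in lborel. indicator N (x /\<^sub>R norm y) = (0::ennreal)"
      by (simp add: nn_integral_0_iff_AE)
    then show ?thesis by eventually_elim (simp add: indicator_eq_0_iff)
  qed
  have "AE y in lborel. AE x in lborel. x /\<^sub>R norm (y::'a) \<notin> N"
    using AE_lborel_singleton[of "0::'a"] by eventually_elim (rule null)
  moreover have "{z \<in> space (lborel \<Otimes>\<^sub>M lborel). fst z /\<^sub>R norm (snd z :: 'a) \<notin> N} \<in> sets (lborel \<Otimes>\<^sub>M lborel)"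
    by measurable
  ultimately have "AE x in lborel. AE y in lborel. x /\<^sub>R norm (y::'a) \<notin> N"
    using lborel_pair.AE_commute[of "\<lambda>x y::'a. x /\<^sub>R norm y \<notin> N"] by simp
  then show ?thesis
    by eventually_elim (use N(1) in \<open>auto elim!: eventually_mono\<close>)
qed

text \<open>Adapted to the integrals in \<open>has_hausdorff\<close>, which are taken over
  \<open>lebesgue\<close> and whose integrands acquire the form \<open>\<Phi>\<close> times radial
  only almost everywhere, after passing to Borel representatives.\<close>

lemma radial_integral_zero_lebesgue:
  fixes \<Phi> F :: "'a::euclidean_space \<Rightarrow> complex" and G :: "real \<Rightarrow> complex"
  assumes [measurable]: "\<Phi> \<in> borel_measurable borel" "G \<in> borel_measurable borel"
    and loc: "\<And>a b. 0 < a \<Longrightarrow> integrable lborel (\<lambda>y. indicator {a..b} (norm y) *\<^sub>R \<Phi> y)"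
    and zero: "\<And>a b. 0 < a \<Longrightarrow> a < b \<Longrightarrow>
      (LINT y|lborel. indicator {a<..<b} (norm y) *\<^sub>R (norm y ^ m *\<^sub>R \<Phi> y)) = 0"
    and F: "integrable lebesgue F" and FG: "AE y in lborel. F y = \<Phi> y * G (norm y)"
  shows "(LINT y|lebesgue. F y) = 0"
proof -
  have m: "(\<lambda>y. \<Phi> y * G (norm y)) \<in> borel_measurable lborel" by measurable
  have ae: "AE y in lebesgue. F y = \<Phi> y * G (norm y)" using FG by (rule AE_completion)
  have "integrable lebesgue (\<lambda>y. \<Phi> y * G (norm y))"
    using integrable_cong_AE_imp[OF F measurable_completion[OF m]] ae by (auto elim: eventually_mono)
  then have "integrable lborel (\<lambda>y. \<Phi> y * G (norm y))"
    using m by (simp add: integrable_completion)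
  then have "(LINT y|lborel. \<Phi> y * G (norm y)) = 0"
    by (intro radial_integral_zero[OF _ _ loc zero]) auto
  moreover have "(LINT y|lebesgue. F y) = (LINT y|lebesgue. \<Phi> y * G (norm y))"
    by (intro integral_cong_AE borel_measurable_integrable F measurable_completion[OF m] ae)
  ultimately show ?thesis using m by (simp add: integral_completion)
qed

section \<open>Lipschitz weights increasing to the indicator of an interval\<close>

definition tent :: "real \<Rightarrow> real \<Rightarrow> real \<Rightarrow> real \<Rightarrow> real" where
  "tent k c d r = min 1 (k * max 0 (min (r - c) (d - r)))"

text \<open>Inside the interval, the tent is \<open>k\<close> times the distance to the nearer end,
  capped at 1. That its Lipschitz constant grows with \<open>k\<close> is harmless: the limit in
  \<open>R\<close> is taken first, for each fixed \<open>k\<close>.\<close>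

lemma tent_lipschitz:
  assumes "0 \<le> k"
  shows "\<bar>tent k c d r - tent k c d s\<bar> \<le> k * \<bar>r - s\<bar>"
proof -
  define u where "u x = max 0 (min (x - c) (d - x))" for x
  have "\<bar>u r - u s\<bar> \<le> \<bar>r - s\<bar>" unfolding u_def by (simp add: min_def max_def abs_if)
  then have "\<bar>k * u r - k * u s\<bar> \<le> k * \<bar>r - s\<bar>"
    using assms by (simp add: right_diff_distrib[symmetric] abs_mult mult_left_mono)
  then show ?thesis unfolding tent_def u_def[symmetric] by (simp add: min_def abs_if split: if_splits)
qed

lemma tent_bounds: "0 \<le> k \<Longrightarrow> 0 \<le> tent k c d r" "tent k c d r \<le> 1"
  by (auto simp: tent_def)

lemma tent_outside: "r \<notin> {c<..<d} \<Longrightarrow> tent k c d r = 0"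
  by (auto simp: tent_def max_def)

lemma tent_tendsto: "(\<lambda>k. tent (real k) c d r) \<longlonglongrightarrow> indicator {c<..<d} r"
proof (cases "r \<in> {c<..<d}")
  case True
  define u where "u = min (r - c) (d - r)"
  have u: "0 < u" using True by (simp add: u_def)
  have "eventually (\<lambda>k. 1 / u \<le> real k) sequentially"
    using filterlim_real_sequentially by (simp add: filterlim_at_top)
  then have "eventually (\<lambda>k. tent (real k) c d r = 1) sequentially"
  proof eventually_elim
    case (elim k)
    then have "1 \<le> real k * u" using u by (simp add: field_simps)
    then show ?case using u by (simp add: tent_def u_def[symmetric])
  qed
  then show ?thesis using True by (simp add: tendsto_eventually)
next
  case False
  then show ?thesis by (simp add: tent_outside)
qed

lemma tent_measurable: "tent k c d \<in> borel_measurable borel"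
  unfolding tent_def by measurable

context bump
begin

text \<open>The concentration argument needs a Lipschitz weight, so sharp annuli are reached from
  tents by dominated convergence. The shell carrying \<open>W\<close> contains the annulus from
  \<open>c\<close> to \<open>d\<close>, so in the limit \<open>W\<close> may be replaced by
  \<open>\<Phi>\<close>.\<close>

lemma annulus_integral_zero:
  fixes \<Phi> :: "real^'n \<Rightarrow> complex"
  assumes [measurable]: "\<Phi> \<in> borel_measurable borel"
    and loc: "\<And>a b. 0 < a \<Longrightarrow> integrable lborel (\<lambda>y. indicator {a..b} (norm y) *\<^sub>R \<Phi> y)"
    and p: "0 < p" "p < 1" and M: "0 \<le> M" and mass: "0 < mass" and cd: "0 < c" "c < d"
    and bound: "\<And>R. R0 \<le> R \<Longrightarrow> (\<integral>\<^sup>+x. indicator {x. norm x / R \<in> {c..d}} x *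
        ennreal (norm (smear (\<lambda>y. indicator {c/4..2*(d+1)} (norm y) *\<^sub>R \<Phi> y) R x) powr p) \<partial>lborel) \<le> ennreal M"
  shows "(LINT y|lborel. indicator {c<..<d} (norm y) *\<^sub>R (norm y ^ CARD('n) *\<^sub>R \<Phi> y)) = 0"
proof -
  define W where "W = (\<lambda>y. indicator {c/4..2*(d+1)} (norm y) *\<^sub>R \<Phi> y)"
  have Wi: "integrable lborel W" unfolding W_def using cd by (intro loc) simp
  have [measurable]: "W \<in> borel_measurable borel" using Wi by auto
  have WB: "norm y \<le> 2 * (d + 1)" if "W y \<noteq> 0" for y
    using that by (auto simp: W_def indicator_def split: if_splits)
  have z: "(LINT y|lborel. W y * of_real (norm y ^ CARD('n) * tent (real k) c d (norm y))) = 0" for k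
  proof (rule weighted_radial_integral_zero[OF Wi WB _ tent_lipschitz _ _ _ _ p M mass, where a = c and b = d and ?R0.0 = R0])
    show "\<bar>tent (real k) c d r\<bar> \<le> 1" for r using tent_bounds[of "real k" c d r] by simp
    show "tent (real k) c d r = 0" if "r \<notin> {c..d}" for r using that by (intro tent_outside) auto
    show "tent (real k) c d \<in> borel_measurable borel" by (rule tent_measurable)
  qed (use bound cd in \<open>simp_all add: W_def\<close>)
  have "(\<lambda>k. LINT y|lborel. W y * of_real (norm y ^ CARD('n) * tent (real k) c d (norm y))) \<longlonglongrightarrow>
      (LINT y|lborel. W y * of_real (norm y ^ CARD('n) * indicator {c<..<d} (norm y)))"
  proof (rule integral_dominated_convergence[where w = "\<lambda>y. (2*(d+1)) ^ CARD('n) * norm (W y)"])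
    show "integrable lborel (\<lambda>y. (2*(d+1)) ^ CARD('n) * norm (W y))" using Wi by simp
    show "AE y in lborel. (\<lambda>k. W y * of_real (norm y ^ CARD('n) * tent (real k) c d (norm y))) \<longlonglongrightarrow>
        W y * of_real (norm y ^ CARD('n) * indicator {c<..<d} (norm y))"
      by (intro AE_I2 tendsto_mult tendsto_const tendsto_of_real tent_tendsto)
    have "norm (W y * of_real (norm y ^ CARD('n) * tent (real k) c d (norm y))) \<le> (2*(d+1)) ^ CARD('n) * norm (W y)" for k y
    proof (cases "W y = 0")
      case False
      have "norm (W y * of_real (norm y ^ CARD('n) * tent (real k) c d (norm y))) =
          norm (W y) * (norm y ^ CARD('n) * tent (real k) c d (norm y))"
        using tent_bounds(1)[of "real k" c d "norm y"] by (simp only: norm_mult norm_of_real abs_mult) simp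
      also have "\<dots> \<le> norm (W y) * ((2*(d+1)) ^ CARD('n) * 1)"
        using WB[OF False] tent_bounds[of "real k" c d "norm y"] cd by (intro mult_left_mono mult_mono power_mono) auto
      finally show ?thesis by (simp add: mult.commute)
    qed simp
    then show "AE y in lborel. norm (W y * of_real (norm y ^ CARD('n) * tent (real k) c d (norm y))) \<le> (2*(d+1)) ^ CARD('n) * norm (W y)" for k
      by simp
    show "(\<lambda>y. W y * of_real (norm y ^ CARD('n) * tent (real k) c d (norm y))) \<in> borel_measurable lborel" for k
      using tent_measurable by measurable
  qed measurable
  then have "(LINT y|lborel. W y * of_real (norm y ^ CARD('n) * indicator {c<..<d} (norm y))) = 0"
    unfolding z by (simp add: LIMSEQ_const_iff)
  moreover have "W y * of_real (norm y ^ CARD('n) * indicator {c<..<d} (norm y)) =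
      indicator {c<..<d} (norm y) *\<^sub>R (norm y ^ CARD('n) *\<^sub>R \<Phi> y)" for y
    using cd by (auto simp: W_def indicator_def scaleR_conv_of_real)
  ultimately show ?thesis by simp
qed

text \<open>For such \<open>x\<close>, every contributing \<open>y\<close> lies in the shell from
  \<open>c / 4\<close> to \<open>2 * (d + 1)\<close>, so cutting \<open>\<Phi>\<close> off there
  changes nothing. The cut kernel is integrable on the whole space, which makes Fubini
  available.\<close>

lemma convolution_eq_smear:
  fixes \<Phi> :: "real^'n \<Rightarrow> complex"
  assumes [measurable]: "\<Phi> \<in> borel_measurable borel"
    and loc: "\<And>a b. 0 < a \<Longrightarrow> integrable lborel (\<lambda>y. indicator {a..b} (norm y) *\<^sub>R \<Phi> y)"
    and cd: "0 < c" "c < d" and R: "2 * \<rho> \<le> R" "2 * \<rho> / c \<le> R" and x: "norm x / R \<in> {c..d}"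
  shows "(LINT z|lborel. (LINT y|lborel. \<Phi> y * of_real (\<beta> (z /\<^sub>R norm y - R *\<^sub>R e))) * of_real (\<beta> (x - z))) =
    smear (\<lambda>y. indicator {c/4..2*(d+1)} (norm y) *\<^sub>R \<Phi> y) R x"
proof -
  have R1: "\<rho> < R" and Rp: "0 < R" using R(1) radius_pos by auto
  define W where "W = (\<lambda>y. indicator {c/4..2*(d+1)} (norm y) *\<^sub>R \<Phi> y)"
  have Wi: "integrable lborel W" unfolding W_def using cd by (intro loc) simp
  have [measurable]: "W \<in> borel_measurable borel" using Wi by auto
  define F where "F z y = W y * of_real (\<beta> (z /\<^sub>R norm y - R *\<^sub>R e) * \<beta> (x - z))" for z y
  have eq: "\<Phi> y * of_real (\<beta> (z /\<^sub>R norm y - R *\<^sub>R e)) * of_real (\<beta> (x - z)) = F z y" for z y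
  proof (cases "\<beta> (z /\<^sub>R norm y - R *\<^sub>R e) * \<beta> (x - z) = 0")
    case False
    have near: "\<bar>norm x - R * norm y\<bar> \<le> \<rho> * (1 + norm y)"
      using kern_integrand_support(1)[OF False R1] .
    have xb: "c * R \<le> norm x" "norm x \<le> d * R" using x Rp by (simp_all add: field_simps)
    \<comment> \<open>The two lower bounds on \<open>R\<close> absorb the errors into half of the
      main terms: \<open>2 * \<rho> \<le> R\<close> handles \<open>\<rho> * norm y\<close> and the
      upper estimate, while \<open>2 * \<rho> / c \<le> R\<close> keeps the lower one positive. This
      yields \<open>norm y \<le> 2 * d + 1\<close> and \<open>norm y \<ge> c / 3\<close>, within the
      shell.\<close>
    have \<rho>1: "\<rho> * norm y \<le> R / 2 * norm y" using R by (intro mult_right_mono) auto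
    have \<rho>2: "\<rho> \<le> c * R / 2" using R(2) cd by (simp add: field_simps)
    have "R * norm y \<le> d * R + R / 2 + R / 2 * norm y"
      using near xb \<rho>1 R(1) by (simp add: algebra_simps abs_le_iff)
    then have "R * norm y \<le> R * (2 * (d + 1))" using Rp by (simp add: algebra_simps)
    then have up: "norm y \<le> 2 * (d + 1)" using Rp by simp
    have "c * R \<le> R * norm y + c * R / 2 + R / 2 * norm y"
      using near xb \<rho>1 \<rho>2 by (simp add: algebra_simps abs_le_iff)
    then have "R * c \<le> R * (3 * norm y)" by (simp add: algebra_simps)
    then have "c \<le> 3 * norm y" using Rp by (simp only: mult_le_cancel_left_pos)
    then have "norm y \<in> {c/4..2*(d+1)}" using up cd by simp
    then show ?thesis by (simp add: F_def W_def)
  qed (auto simp: F_def)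
  have pair: "integrable (lborel \<Otimes>\<^sub>M lborel) (\<lambda>(z, y). F z y)"
  proof (rule Bochner_Integration.integrable_bound)
    show "integrable (lborel \<Otimes>\<^sub>M lborel) (\<lambda>(z, y). \<beta> (x - z) * norm (W y))"
      using reflected_bump(1)[of x] Wi by (intro integrable_pair_product) auto
    show "(\<lambda>(z, y). F z y) \<in> borel_measurable (lborel \<Otimes>\<^sub>M lborel)" unfolding F_def by measurable
    have "norm (F z y) \<le> \<beta> (x - z) * norm (W y)" for z y
    proof -
      have "norm (F z y) = norm (W y) * (\<beta> (z /\<^sub>R norm y - R *\<^sub>R e) * \<beta> (x - z))"
        by (simp only: F_def norm_mult norm_of_real) (simp add: bump_nonneg)
      also have "\<dots> \<le> norm (W y) * \<beta> (x - z)" by (intro mult_left_mono kern_integrand_le) simp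
      finally show ?thesis by (simp add: mult.commute)
    qed
    then show "AE w in lborel \<Otimes>\<^sub>M lborel. norm (case w of (z, y) \<Rightarrow> F z y) \<le> norm (case w of (z, y) \<Rightarrow> \<beta> (x - z) * norm (W y))"
      by (auto simp: abs_mult bump_nonneg intro!: AE_I2)
  qed
  have "(LINT z|lborel. (LINT y|lborel. \<Phi> y * of_real (\<beta> (z /\<^sub>R norm y - R *\<^sub>R e))) * of_real (\<beta> (x - z))) =
      (LINT z|lborel. LINT y|lborel. F z y)"
    by (simp only: integral_mult_left_zero[symmetric] eq)
  also have "\<dots> = (LINT y|lborel. LINT z|lborel. F z y)"
    by (rule lborel_pair.Fubini_integral[symmetric]) (rule pair)
  also have "\<dots> = smear W R x"
    by (simp only: smear_def kern_def F_def integral_mult_right_zero integral_complex_of_real)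
  finally show ?thesis unfolding W_def .
qed

text \<open>The passage from distributions to pointwise estimates. The representatives
  \<open>f\<close> and \<open>h\<close> are known only almost everywhere, but convolution with a
  test function turns this into an identity at every point. The embedding asks for a test function,
  so smoothness of \<open>\<beta>\<close> enters here.\<close>

lemma smear_Lp_bound:
  fixes \<Phi> \<Phi>0 f h :: "real^'n \<Rightarrow> complex"
  defines "\<phi> \<equiv> (\<lambda>x. complex_of_real (\<beta> x))"
  assumes \<phi>: "\<phi> \<in> test_functions"
    and [measurable]: "\<Phi> \<in> borel_measurable borel" and \<Phi>0: "AE y in lborel. \<Phi>0 y = \<Phi> y"
    and loc: "\<And>a b. 0 < a \<Longrightarrow> integrable lborel (\<lambda>y. indicator {a..b} (norm y) *\<^sub>R \<Phi> y)"
    and f: "f locally_integrable_on UNIV" "fun_distr f = fun_distr (\<lambda>x. \<phi> (x - R *\<^sub>R e))"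
    and h: "h locally_integrable_on UNIV"
    and H: "AE x in lebesgue. integrable lebesgue (\<lambda>y. \<Phi>0 y * f (x /\<^sub>R norm y)) \<and> h x = hausdorff_fun \<Phi>0 f x"
    and p: "0 < p" and Lp: "in_Lp p (convol \<phi> (fun_distr h))" "Lp_norm p (convol \<phi> (fun_distr h)) \<le> Q"
    and cd: "0 < c" "c < d" and R: "2 * \<rho> \<le> R" "2 * \<rho> / c \<le> R"
  shows "(\<integral>\<^sup>+x. indicator {x. norm x / R \<in> {c..d}} x *
      ennreal (norm (smear (\<lambda>y. indicator {c/4..2*(d+1)} (norm y) *\<^sub>R \<Phi> y) R x) powr p) \<partial>lborel) \<le> ennreal (Q powr p)"
proof -
  have [measurable]: "\<phi> \<in> borel_measurable borel" unfolding \<phi>_def by measurable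
  have shift: "(\<lambda>x. \<phi> (x - R *\<^sub>R e)) \<in> test_functions"
    using test_function_shift_iff[of \<phi> "- (R *\<^sub>R e)"] \<phi> by simp
  have shift_loc: "(\<lambda>x. \<phi> (x - R *\<^sub>R e)) locally_integrable_on UNIV"
    by (rule test_function_locally_integrable[OF shift])
  have "AE x in lborel. f x = \<phi> (x - R *\<^sub>R e)"
    using fun_distr_inject_AE[OF f(1) shift_loc f(2)] by (simp add: AE_completion_iff)
  then have f_ae: "AE x in lborel. AE y in lborel. f (x /\<^sub>R norm (y::real^'n)) = \<phi> (x /\<^sub>R norm y - R *\<^sub>R e)"
    by (rule AE_dilation)
  \<comment> \<open>A Borel version of the image of the translated bump; the defining integral
    converges for almost every \<open>z\<close>, where it agrees with \<open>h\<close>.\<close>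
  define D where "D z = (LINT y|lborel. \<Phi> y * of_real (\<beta> (z /\<^sub>R norm y - R *\<^sub>R e)))" for z
  have Dm[measurable]: "D \<in> borel_measurable borel" unfolding D_def by measurable
  have "AE x in lborel. h x = D x"
    using f_ae H[unfolded AE_completion_iff]
  proof eventually_elim
    case (elim x)
    have m: "(\<lambda>y. \<Phi> y * \<phi> (x /\<^sub>R norm y - R *\<^sub>R e)) \<in> borel_measurable lborel" by measurable
    have "h x = (LINT y|lebesgue. \<Phi>0 y * f (x /\<^sub>R norm y))" using elim by (simp add: hausdorff_fun_def)
    also have "\<dots> = (LINT y|lebesgue. \<Phi> y * \<phi> (x /\<^sub>R norm y - R *\<^sub>R e))"
    proof (rule integral_cong_AE)
      show "AE y in lebesgue. \<Phi>0 y * f (x /\<^sub>R norm y) = \<Phi> y * \<phi> (x /\<^sub>R norm y - R *\<^sub>R e)"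
        unfolding AE_completion_iff using \<Phi>0 elim(1) by eventually_elim simp
    qed (use elim measurable_completion[OF m] in auto)
    also have "\<dots> = D x" using m by (simp add: integral_completion D_def \<phi>_def)
    finally show ?case .
  qed
  then have h_ae: "AE x in lebesgue. h x = D x" by (rule AE_completion)
  have conv: "convol \<phi> (fun_distr h) x = (LINT z|lborel. D z * \<phi> (x - z))" for x
  proof -
    have "(\<lambda>z. \<phi> (x - z)) \<in> test_functions" using test_function_affine[OF \<phi>, of "-1" x] by simp
    then have "convol \<phi> (fun_distr h) x = (LINT z|lebesgue. h z * \<phi> (x - z))"
      by (simp add: convol_def fun_distr_def)
    also have "\<dots> = (LINT z|lebesgue. D z * \<phi> (x - z))"
    proof (rule integral_cong_AE)
      have "(\<lambda>z. \<phi> (x - z)) \<in> borel_measurable lebesgue" by (rule measurable_completion) measurable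
      moreover have "h \<in> borel_measurable lebesgue" using h by (simp add: locally_integrable_on_def lebesgue_on_UNIV_eq)
      ultimately show "(\<lambda>z. h z * \<phi> (x - z)) \<in> borel_measurable lebesgue" by simp
      show "(\<lambda>z. D z * \<phi> (x - z)) \<in> borel_measurable lebesgue" by (rule measurable_completion) measurable
      show "AE z in lebesgue. h z * \<phi> (x - z) = D z * \<phi> (x - z)" using h_ae by eventually_elim simp
    qed
    also have "\<dots> = (LINT z|lborel. D z * \<phi> (x - z))" by (rule integral_completion) measurable
    finally show ?thesis .
  qed
  have Wi: "integrable lborel (\<lambda>y. indicator {c/4..2*(d+1)} (norm y) *\<^sub>R \<Phi> y)" using cd by (intro loc) simp
  let ?s = "smear (\<lambda>y. indicator {c/4..2*(d+1)} (norm y) *\<^sub>R \<Phi> y) R"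
  have [measurable]: "?s \<in> borel_measurable borel" by (rule smear_measurable[OF Wi])
  have conv': "convol \<phi> (fun_distr h) x = ?s x" if "norm x / R \<in> {c..d}" for x
    unfolding conv unfolding D_def \<phi>_def by (rule convolution_eq_smear[OF _ loc cd R that]) auto
  have "(\<integral>\<^sup>+x. indicator {x. norm x / R \<in> {c..d}} x * ennreal (norm (?s x) powr p) \<partial>lborel) =
      (\<integral>\<^sup>+x. indicator {x. norm x / R \<in> {c..d}} x * ennreal (norm (?s x) powr p) \<partial>lebesgue)"
    by (simp add: nn_integral_completion)
  also have "\<dots> \<le> (\<integral>\<^sup>+x. ennreal (norm (convol \<phi> (fun_distr h) x) powr p) \<partial>lebesgue)"
    by (intro nn_integral_mono) (auto simp: indicator_def conv')
  also have "\<dots> = ennreal (LINT x|lebesgue. norm (convol \<phi> (fun_distr h) x) powr p)"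
    using Lp(1) by (intro nn_integral_eq_integral) (auto simp: in_Lp_def)
  also have "\<dots> \<le> ennreal (Q powr p)"
  proof (rule ennreal_leI)
    have "(LINT x|lebesgue. norm (convol \<phi> (fun_distr h) x) powr p) = Lp_norm p (convol \<phi> (fun_distr h)) powr p"
      using p by (simp add: Lp_norm_def powr_powr Bochner_Integration.integral_nonneg)
    also have "\<dots> \<le> Q powr p"
      using p Lp(2) by (intro powr_mono2) (auto simp: Lp_norm_def)
    finally show "(LINT x|lebesgue. norm (convol \<phi> (fun_distr h) x) powr p) \<le> Q powr p" .
  qed
  finally show ?thesis .
qed

end

section \<open>Existence of a bump, translated functions, and the equivalence\<close>

lemma ex_bump:
  fixes e :: "real^'n"
  assumes "norm e = 1"
  obtains \<beta> \<rho> where "bump \<beta> \<rho> e" "(\<lambda>x::real^'n. complex_of_real (\<beta> x)) \<in> test_functions" "0 < bump.mass \<beta>"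
proof -
  define \<beta> where "\<beta> = box_bump 1 ((\<chi> i. - 1)::real^'n) (\<chi> i. 1)"
  have t: "(\<lambda>x. complex_of_real (\<beta> x)) \<in> test_functions"
    unfolding \<beta>_def by (rule box_bump_test_function) auto
  obtain B r where "B > 0" and r: "r > 0"
    and "\<And>x. norm (complex_of_real (\<beta> x)) \<le> B" and r0: "\<And>x. norm x > r \<Longrightarrow> complex_of_real (\<beta> x) = 0"
    by (rule test_function_bounded[OF t]) (rule that)
  have "(\<lambda>x. complex_of_real (\<beta> x)) \<in> borel_measurable borel"
    using t by (simp add: test_functions_def smooth_measurable)
  then have "\<beta> \<in> borel_measurable borel"
    by (simp add: borel_measurable_complex_iff)
  then have b: "bump \<beta> r e"
    using r r0 assms by unfold_locales (auto simp: \<beta>_def box_bump_nonneg box_bump_le_1)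
  then interpret bump \<beta> r e .
  have "mass \<noteq> 0"
  proof
    assume "mass = 0"
    then have "AE x in lborel. \<beta> x = 0"
      unfolding mass_def using bump_integrable bump_nonneg by (subst (asm) integral_nonneg_eq_0_iff_AE) auto
    then have "AE x in lborel. x \<notin> box ((\<chi> i. - 1)::real^'n) (\<chi> i. 1)"
    proof eventually_elim
      case (elim x)
      then show ?case
        using box_bump_pos[of x "(\<chi> i. - 1)::real^'n" "\<chi> i. 1" 1] unfolding \<beta>_def by linarith
    qed
    then have "AE x in lebesgue. x \<notin> box ((\<chi> i. - 1)::real^'n) (\<chi> i. 1)" by (rule AE_completion)
    then have "negligible (box ((\<chi> i. - 1)::real^'n) (\<chi> i. 1))"
      using AE_iff_null_sets[of "box ((\<chi> i. - 1)::real^'n) (\<chi> i. 1)" lebesgue] by (simp add: negligible_iff_null_sets)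
    moreover have "0 \<in> box ((\<chi> i. - 1)::real^'n) (\<chi> i. 1)" by (simp add: mem_box_cart)
    ultimately show False using open_not_negligible[OF open_box] by blast
  qed
  then show ?thesis using that[OF b t] mass_nonneg by simp
qed

lemma translate_fun_distr:
  fixes f :: "real^'n \<Rightarrow> complex"
  assumes "f \<in> test_functions"
  shows "translate y (fun_distr f) = fun_distr (\<lambda>x. f (x - y))"
proof
  fix \<phi> :: "real^'n \<Rightarrow> complex"
  show "translate y (fun_distr f) \<phi> = fun_distr (\<lambda>x. f (x - y)) \<phi>"
  proof (cases "\<phi> \<in> test_functions")
    case True
    have [measurable]: "f \<in> borel_measurable borel" "\<phi> \<in> borel_measurable borel"
      using assms True by (simp_all add: test_functions_def smooth_measurable)
    have "(LINT x|lebesgue. f x * \<phi> (x + y)) = (LINT x|lborel. f x * \<phi> (x + y))"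
      by (rule integral_completion) measurable
    also have "\<dots> = (LINT x|lborel. f (- y + 1 *\<^sub>R x) * \<phi> (- y + 1 *\<^sub>R x + y))"
      by (subst lborel_integral_affine) auto
    also have "\<dots> = (LINT x|lborel. f (x - y) * \<phi> x)" by simp
    also have "\<dots> = (LINT x|lebesgue. f (x - y) * \<phi> x)"
      by (rule integral_completion[symmetric]) measurable
    finally show ?thesis using True by (simp add: translate_def fun_distr_def test_function_shift_iff)
  qed (simp add: translate_def fun_distr_def test_function_shift_iff)
qed

theorem theorem3p3:
  fixes p :: real
    and \<Phi> :: "real^'n::finite \<Rightarrow> complex"
    and X :: "'n functional set"
    and N :: "'n functional \<Rightarrow> real"
  assumes "0 < p" and "p < 1"
    and "\<Phi> locally_integrable_on (- {0})"
    and "quasi_banach X N"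
    and "translation_invariant X N"
    and "\<And>\<phi>. \<phi> \<in> test_functions \<Longrightarrow> fun_distr \<phi> \<in> X"
    and "embeds_Lp0 p X N"
  shows "hausdorff_bounded \<Phi> X N \<longleftrightarrow> hausdorff_zero \<Phi> X"
proof
  have X: "X \<subseteq> distributions" "(\<lambda>\<phi>. 0) \<in> X" "N (\<lambda>\<phi>. 0) = 0" and N0: "\<And>u. u \<in> X \<Longrightarrow> 0 \<le> N u"
    using assms(4) unfolding quasi_banach_def by blast+
  \<comment> \<open>The zero distribution belongs to \<open>X\<close> and has quasi-norm 0, so it
    serves as the image of every \<open>u\<close> with the constant 0.\<close>
  show "hausdorff_bounded \<Phi> X N" if "hausdorff_zero \<Phi> X"
    unfolding hausdorff_bounded_def
    using that X(2,3) unfolding hausdorff_zero_def by (intro exI[of _ 0]) auto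
  assume bounded: "hausdorff_bounded \<Phi> X N"
  \<comment> \<open>Measurability of \<open>\<Phi>\<close> is given only away from the origin. The
    value there is set to 0, a change on a null set.\<close>
  have "(\<lambda>y. if y \<in> - {0} then \<Phi> y else 0) \<in> borel_measurable lebesgue"
    using assms(3) by (intro borel_measurable_if_I) (auto simp: locally_integrable_on_def)
  then obtain \<Psi> where \<Psi>[measurable]: "\<Psi> \<in> borel_measurable borel"
    and ae: "AE y in lborel. (if y \<in> - {0} then \<Phi> y else 0) = \<Psi> y"
    by (rule lebesgue_measurable_complex_ex_borel)
  have \<Psi>_ae: "AE y in lborel. \<Phi> y = \<Psi> y"
    using ae AE_lborel_singleton[of "0::real^'n"] by eventually_elim simp
  have loc: "integrable lborel (\<lambda>y. indicator {a..b} (norm y) *\<^sub>R \<Psi> y)" if "0 < a" for a b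
  proof -
    have "compact (cball (0::real^'n) b - ball 0 a)" by (intro compact_diff) auto
    moreover have "cball (0::real^'n) b - ball 0 a \<subseteq> - {0}" using that by auto
    ultimately have "set_integrable lebesgue (cball (0::real^'n) b - ball 0 a) \<Phi>"
      using assms(3) by (simp add: locally_integrable_on_def)
    moreover have "indicator (cball (0::real^'n) b - ball 0 a) y = (indicator {a..b} (norm y) :: real)" for y
      by (auto simp: indicator_def)
    ultimately have i: "integrable lebesgue (\<lambda>y. indicator {a..b} (norm y) *\<^sub>R \<Phi> y)"
      by (simp add: set_integrable_def)
    have m: "(\<lambda>y::real^'n. indicator {a..b} (norm y) *\<^sub>R \<Psi> y) \<in> borel_measurable lborel" by measurable
    have "integrable lebesgue (\<lambda>y. indicator {a..b} (norm y) *\<^sub>R \<Psi> y)"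
      by (rule integrable_cong_AE_imp[OF i measurable_completion[OF m]])
         (use AE_completion[OF \<Psi>_ae] in eventually_elim, simp)
    then show ?thesis using m by (simp add: integrable_completion)
  qed
  obtain e :: "real^'n" where e: "norm e = 1" using norm_axis_1 by blast
  obtain \<beta> \<rho> where bump: "bump \<beta> \<rho> e" and \<phi>: "(\<lambda>x::real^'n. complex_of_real (\<beta> x)) \<in> test_functions"
    and mass: "0 < bump.mass \<beta>"
    using ex_bump[OF e] by blast
  interpret bump \<beta> \<rho> e by (rule bump)
  define \<phi> where "\<phi> = (\<lambda>x. complex_of_real (\<beta> x))"
  obtain C1 where C1: "\<And>u. u \<in> X \<Longrightarrow> in_Lp p (convol \<phi> u) \<and> Lp_norm p (convol \<phi> u) \<le> C1 * N u"
    using assms(7) \<phi> unfolding embeds_Lp0_def \<phi>_def by blast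
  obtain C2 where C2: "\<And>u. u \<in> X \<Longrightarrow> \<exists>v\<in>X. has_hausdorff \<Phi> u v \<and> N v \<le> C2 * N u"
    using bounded unfolding hausdorff_bounded_def by blast
  \<comment> \<open>Translation invariance makes \<open>Q\<close> independent of \<open>R\<close>.
    The absolute value is taken because the sign of \<open>C1\<close> is unknown and the estimate
    for \<open>N v\<close> is multiplied by it.\<close>
  define Q where "Q = \<bar>C1\<bar> * (C2 * N (fun_distr \<phi>))"
  have bound: "(\<integral>\<^sup>+x. indicator {x. norm x / R \<in> {c..d}} x *
      ennreal (norm (smear (\<lambda>y. indicator {c/4..2*(d+1)} (norm y) *\<^sub>R \<Psi> y) R x) powr p) \<partial>lborel) \<le> ennreal (Q powr p)"
    if R: "max (2 * \<rho>) (2 * \<rho> / c) \<le> R" and cd: "0 < c" "c < d" for c d R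
  proof -
    define u where "u = fun_distr (\<lambda>x. \<phi> (x - R *\<^sub>R e))"
    have shift: "(\<lambda>x. \<phi> (x - R *\<^sub>R e)) \<in> test_functions"
      using test_function_shift_iff[of \<phi> "- (R *\<^sub>R e)"] \<phi> by (simp add: \<phi>_def)
    have u: "u = translate (R *\<^sub>R e) (fun_distr \<phi>)"
      using \<phi> unfolding u_def \<phi>_def by (simp add: translate_fun_distr)
    have "u \<in> X" "N u = N (fun_distr \<phi>)"
      using assms(5) assms(6)[OF \<phi>] unfolding u translation_invariant_def \<phi>_def by auto
    then obtain v where v: "v \<in> X" "has_hausdorff \<Phi> u v" "N v \<le> C2 * N (fun_distr \<phi>)"
      using C2 by metis
    \<comment> \<open>This selects the branch of \<open>has_hausdorff\<close> for functions, so that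
      the image \<open>v\<close> is again given by a function.\<close>
    have "(\<lambda>x. \<phi> (x - R *\<^sub>R e)) locally_integrable_on UNIV"
      by (rule test_function_locally_integrable[OF shift])
    then have "\<exists>f. f locally_integrable_on UNIV \<and> u = fun_distr f" unfolding u_def by blast
    then obtain f h where fh: "f locally_integrable_on UNIV" "u = fun_distr f"
      "h locally_integrable_on UNIV" "v = fun_distr h"
      "AE x in lebesgue. integrable lebesgue (\<lambda>y. \<Phi> y * f (x /\<^sub>R norm y)) \<and> h x = hausdorff_fun \<Phi> f x"
      using v(2) unfolding has_hausdorff_def by auto
    have "Lp_norm p (convol \<phi> v) \<le> C1 * N v" using C1[OF v(1)] by simp
    also have "\<dots> \<le> \<bar>C1\<bar> * N v" using N0[OF v(1)] by (intro mult_right_mono) auto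
    also have "\<dots> \<le> Q" unfolding Q_def using v(3) by (intro mult_left_mono) auto
    finally have "Lp_norm p (convol \<phi> (fun_distr h)) \<le> Q" using fh(4) by simp
    moreover have "in_Lp p (convol \<phi> (fun_distr h))" using C1[OF v(1)] fh(4) by simp
    moreover have "fun_distr f = fun_distr (\<lambda>x. \<phi> (x - R *\<^sub>R e))" using fh(2) u_def by simp
    ultimately show ?thesis
      using smear_Lp_bound[OF \<phi> \<Psi> \<Psi>_ae loc fh(1) _ fh(3) fh(5) assms(1) _ _ cd] R by (simp add: \<phi>_def)
  qed
  have zero: "(LINT y|lborel. indicator {c<..<d} (norm y) *\<^sub>R (norm y ^ CARD('n) *\<^sub>R \<Psi> y)) = 0" if "0 < c" "c < d" for c d
    by (rule annulus_integral_zero[OF \<Psi> loc assms(1,2) _ mass that bound[OF _ that], of "max (2 * \<rho>) (2 * \<rho> / c)"])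
      auto
  have vanish: "(LINT y|lebesgue. F y) = 0"
    if "G \<in> borel_measurable borel" "integrable lebesgue F" "AE y in lborel. F y = \<Psi> y * G (norm y)" for F G
    by (rule radial_integral_zero_lebesgue[OF \<Psi> that(1) loc zero that(2,3)])
  show "hausdorff_zero \<Phi> X"
    unfolding hausdorff_zero_def
  proof
    fix u assume u: "u \<in> X"
    \<comment> \<open>Boundedness is invoked for this arbitrary \<open>u\<close> to obtain
      convergence of the defining integrals, which \<open>has_hausdorff\<close> demands of the value
      0 as well.\<close>
    then obtain v where v: "has_hausdorff \<Phi> u v" using C2 by blast
    show "has_hausdorff \<Phi> u (\<lambda>\<phi>. 0)"
    proof (cases "\<exists>f. f locally_integrable_on UNIV \<and> u = fun_distr f")
      case True
      then obtain f h where fh: "f locally_integrable_on UNIV" "u = fun_distr f"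
        "AE x in lebesgue. integrable lebesgue (\<lambda>y. \<Phi> y * f (x /\<^sub>R norm y)) \<and> h x = hausdorff_fun \<Phi> f x"
        using v unfolding has_hausdorff_def by auto
      have "f \<in> borel_measurable lebesgue" using fh(1) by (simp add: locally_integrable_on_def lebesgue_on_UNIV_eq)
      then obtain g where g[measurable]: "g \<in> borel_measurable borel" and "AE x in lborel. f x = g x"
        by (rule lebesgue_measurable_complex_ex_borel)
      from AE_dilation[OF this(2)]
      have g_ae: "AE x in lborel. AE y in lborel. f (x /\<^sub>R norm (y::real^'n)) = g (x /\<^sub>R norm y)" .
      have "AE x in lborel. integrable lebesgue (\<lambda>y. \<Phi> y * f (x /\<^sub>R norm y)) \<and> 0 = hausdorff_fun \<Phi> f x"
        using g_ae fh(3)[unfolded AE_completion_iff]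
      proof eventually_elim
        case (elim x)
        have "(LINT y|lebesgue. \<Phi> y * f (x /\<^sub>R norm y)) = 0"
        \<comment> \<open>For fixed \<open>x\<close>, the integrand is \<open>\<Psi>\<close> times a
          function of \<open>norm y\<close> alone.\<close>
        proof (rule vanish[where G = "\<lambda>r. g (x /\<^sub>R r)"])
          show "AE y in lborel. \<Phi> y * f (x /\<^sub>R norm y) = \<Psi> y * g (x /\<^sub>R norm y)"
            using \<Psi>_ae elim(1) by eventually_elim simp
        qed (use elim in auto)
        then show ?case using elim by (simp add: hausdorff_fun_def)
      qed
      then have "AE x in lebesgue. integrable lebesgue (\<lambda>y. \<Phi> y * f (x /\<^sub>R norm y)) \<and> 0 = hausdorff_fun \<Phi> f x"
        by (rule AE_completion)
      moreover have "(\<lambda>x::real^'n. 0) locally_integrable_on UNIV"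
        by (simp add: locally_integrable_on_def set_integrable_def)
      moreover have "(\<lambda>\<phi>. 0) = fun_distr (\<lambda>x::real^'n. 0)"
        by (simp add: fun_distr_def fun_eq_iff)
      ultimately have "\<exists>f h. f locally_integrable_on UNIV \<and> u = fun_distr f \<and>
          h locally_integrable_on UNIV \<and> (\<lambda>\<phi>. 0) = fun_distr h \<and>
          (AE x in lebesgue. integrable lebesgue (\<lambda>y. \<Phi> y * f (x /\<^sub>R norm y)) \<and> h x = hausdorff_fun \<Phi> f x)"
        using fh(1,2) by (intro exI[of _ f] exI[of _ "\<lambda>x. 0"]) simp
      then show ?thesis unfolding has_hausdorff_def if_P[OF True] .
    next
      case False
      have i: "integrable lebesgue (\<lambda>y. \<Phi> y * (of_real (norm y ^ CARD('n)) * u (\<lambda>x. g (norm y *\<^sub>R x))))"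
        if "g \<in> test_functions" for g
        using v that unfolding has_hausdorff_def if_not_P[OF False] by blast
      have z: "(LINT y|lebesgue. \<Phi> y * (of_real (norm y ^ CARD('n)) * u (\<lambda>x. g (norm y *\<^sub>R x)))) = 0"
        if g: "g \<in> test_functions" for g
      \<comment> \<open>The dilated distribution is likewise radial in \<open>y\<close>. Its
        continuity, and thus Borel measurability, is available for positive \<open>r\<close>;
        cutting off at 0 alters the integrand at most at the origin.\<close>
      proof (rule vanish[OF _ i[OF g], where G = "\<lambda>r. indicator {0<..} r *\<^sub>R (of_real (r ^ CARD('n)) * u (\<lambda>x. g (r *\<^sub>R x)))"])
        have "continuous_on {0<..} (\<lambda>r::real. of_real (r ^ CARD('n)) * u (\<lambda>x. g (r *\<^sub>R x)))"
          using u X(1) g by (intro continuous_intros distribution_dilation_continuous) auto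
        then show "(\<lambda>r. indicator {0<..} r *\<^sub>R (of_real (r ^ CARD('n)) * u (\<lambda>x. g (r *\<^sub>R x)))) \<in> borel_measurable borel"
          by (intro borel_measurable_continuous_on_indicator) auto
        show "AE y in lborel. \<Phi> y * (of_real (norm y ^ CARD('n)) * u (\<lambda>x. g (norm y *\<^sub>R x))) =
            \<Psi> y * (indicator {0<..} (norm y) *\<^sub>R (of_real (norm y ^ CARD('n)) * u (\<lambda>x. g (norm y *\<^sub>R x))))"
          using \<Psi>_ae AE_lborel_singleton[of "0::real^'n"] by eventually_elim simp
      qed
      have "(\<lambda>\<phi>. 0) \<in> (distributions :: 'n functional set)" using X(1,2) by (rule subsetD)
      then show ?thesis unfolding has_hausdorff_def if_not_P[OF False] using i z by simp
    qed
  qed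
qed

end
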